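(* Let $n\ge1$ and $M>0$. Consider the class of all functions $$F(z):=\int_0^z\prod_{i=1}^n\left(f_i'(t)\right)^{\gamma_i}\,dt\qquad(z\in\Delta),$$ where $f_i\in\mathcal{S}$ $(1\le i\le n)$ and $\gamma_1,\ldots,\gamma_n\in\mathbb{C}$ satisfy $\sum_{i=1}^n|\gamma_i|\le M$. Then the radius of convexity of this class of integral operators is $$r=\frac{1}{\sqrt{4M^2+2M+1}+2M}.$$
   Context: $\Delta=\{z\in\mathbb{C}:|z|<1\}$. $\mathcal{A}$ is the set of functions $f$ analytic in $\Delta$ with $f(z)=z+a_2z^2+\cdots$. $\mathcal{S}$ is the set of univalent (injective) functions $f\in\mathcal{A}$. The powers $(f_i')^{\gamma_i}$ are the analytic branches equal to $1$ at the origin. The radius of convexity of a class of such functions $F$ is the largest number $r\in(0,1)$ for which $\min_{|z|=r}\mathrm{Re}\left\{1+\frac{zF''(z)}{F'(z)}\right\}\ge 0$ for every $F$ in the class. *)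

theory Defs
  imports "HOL-Complex_Analysis.Complex_Analysis"
begin

abbreviation unit_disc :: "complex set" where
  "unit_disc \<equiv> ball 0 1"

definition class_A :: "(complex \<Rightarrow> complex) set" where
  "class_A = {f. f analytic_on unit_disc \<and> f 0 = 0 \<and> deriv f 0 = 1}"

definition class_S :: "(complex \<Rightarrow> complex) set" where
  "class_S = {f \<in> class_A. inj_on f unit_disc}"

text \<open>
  \<open>p\<close> is, on the unit disc, the analytic branch of \<open>g\<^sup>c\<close> (complex exponent \<open>c\<close>) that equals 1 at
  the origin.  Note that \<open>powr\<close> would not do: it uses the principal logarithm, which is not
  analytic along \<open>g\<close> as soon as \<open>g\<close> meets the negative real axis.  The logarithm \<open>L\<close> is only
  determined up to \<open>2\<pi>ik\<close>; the normalisation at 0 determines \<open>p\<close> uniquely on the disc.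
\<close>

definition power_branch ::
  "(complex \<Rightarrow> complex) \<Rightarrow> complex \<Rightarrow> (complex \<Rightarrow> complex) \<Rightarrow> bool" where
  "power_branch g c p \<longleftrightarrow>
     (\<exists>L. L analytic_on unit_disc \<and>
          (\<forall>z\<in>unit_disc. exp (L z) = g z \<and> p z = exp (c * L z))) \<and>
     p 0 = 1"

text \<open>
  Members are only constrained on the disc; their values elsewhere are irrelevant.  The integrand
  is analytic on the disc, so integrating along the segment from 0 to \<open>z\<close> is no restriction.
\<close>

definition integral_operators :: "nat \<Rightarrow> real \<Rightarrow> (complex \<Rightarrow> complex) set" where
  "integral_operators n M =
     {F. \<exists>(f :: nat \<Rightarrow> complex \<Rightarrow> complex) (\<gamma> :: nat \<Rightarrow> complex) (p :: nat \<Rightarrow> complex \<Rightarrow> complex).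
           (\<forall>i\<in>{1..n}. f i \<in> class_S \<and> power_branch (deriv (f i)) (\<gamma> i) (p i)) \<and>
           (\<Sum>i=1..n. norm (\<gamma> i)) \<le> M \<and>
           (\<forall>z\<in>unit_disc. F z = contour_integral (linepath 0 z) (\<lambda>t. \<Prod>i=1..n. p i t))}"

definition convexity_quantity :: "(complex \<Rightarrow> complex) \<Rightarrow> complex \<Rightarrow> real" where
  "convexity_quantity F z = Re (1 + z * deriv (deriv F) z / deriv F z)"

definition min_on_circle_nonneg :: "(complex \<Rightarrow> real) \<Rightarrow> real \<Rightarrow> bool" where
  "min_on_circle_nonneg q r \<longleftrightarrow>
     (\<exists>z\<^sub>0\<in>sphere 0 r. (\<forall>z\<in>sphere 0 r. q z\<^sub>0 \<le> q z) \<and> q z\<^sub>0 \<ge> 0)"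

definition convexity_radii :: "(complex \<Rightarrow> complex) set \<Rightarrow> real set" where
  "convexity_radii C =
     {r \<in> {0<..<1}. \<forall>F\<in>C. min_on_circle_nonneg (convexity_quantity F) r}"

definition is_radius_of_convexity :: "(complex \<Rightarrow> complex) set \<Rightarrow> real \<Rightarrow> bool" where
  "is_radius_of_convexity C r \<longleftrightarrow>
     r \<in> convexity_radii C \<and> (\<forall>s\<in>convexity_radii C. s \<le> r)"

end

(*
  Since z F'' / F' is the sum of the gamma_i z f_i'' / f_i', the theorem follows from the sharp
  estimate |z f'' / f'| <= (4r + 2r^2) / (1 - r^2) on |z| = r for f in S, with equality at z = r for
  the Koebe function; gamma_1 = -M is extremal.  The estimate is |a_2| <= 2 applied to the Koebe
  transform of f.  |a_2| <= 2 in turn is the area theorem for g(z) = 1 / sqrt (f (z^2)) = 1/z + b z + ....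

  For the area theorem, fix a small rho and shear by T w = w - b rho^2 cnj w.  This turns the
  near-elliptic image of |z| = rho under g into a near-circle: |T (g z)| <= 1/rho + O(rho^2).  By
  injectivity and connectedness of the exterior of a disc, T o g maps rho <= |z| < 1 into the same
  disc, so the area of the image of rho < |z| < r, computed by change of variables in logarithmic
  coordinates, is at most pi/rho^2 + O(rho).  Letting rho -> 0 and then r -> 1 gives |b| <= 1.
*)
theory Submission
  imports Defs
begin

section \<open>Area of sheared holomorphic images\<close>

text \<open>The shear is what makes the bound sharp. For g(z) = 1/z + b z + ... the circle |z| =
  \<rho> goes nearly to an ellipse with semi-axes 1/\<rho> + |b| \<rho> and 1/\<rho> - |b| \<rho>. A
  circumscribed disc has area pi (1/\<rho>^2 + 2 |b| + O(\<rho>)), and the excess 2 pi |b| survives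
  \<rho> -> 0: comparison with that disc yields only |b|^2 - 1 \<le> 2 |b|. The shear rounds the
  ellipse at the price of a Jacobian 1 - |b|^2 \<rho>^4, which alters the leading term 1/\<rho>^2
  only by |b|^2 \<rho>^2, so every error vanishes in the limit. The logarithmic coordinate turns an
  annulus into a rectangle, where the area is an iterated integral whose inner integrals are circle
  means of |z g'(z)|^2. Orthogonality of the powers of z on circles bounds these from below by the
  coefficients of 1/z and z alone.\<close>

definition complex_of_vec :: "real^2 \<Rightarrow> complex" where
  "complex_of_vec v = Complex (v $ 1) (v $ 2)"

definition vec_of_complex :: "complex \<Rightarrow> real^2" where
  "vec_of_complex z = vector [Re z, Im z]"

lemma complex_of_vec_of_complex [simp]: "complex_of_vec (vec_of_complex z) = z"
  by (simp add: complex_of_vec_def vec_of_complex_def)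

lemma vec_of_complex_of_vec [simp]: "vec_of_complex (complex_of_vec v) = v"
  by (simp add: complex_of_vec_def vec_of_complex_def vec_eq_iff forall_2)

lemma norm_complex_of_vec [simp]: "cmod (complex_of_vec v) = norm v"
  by (simp add: complex_of_vec_def norm_complex_def norm_vec_def L2_set_def sum_2)

lemma norm_vec_of_complex [simp]: "norm (vec_of_complex z) = cmod z"
  by (simp flip: norm_complex_of_vec)

lemma bounded_linear_complex_of_vec: "bounded_linear complex_of_vec"
  by (rule bounded_linear_intro[where K = 1])
     (simp_all add: complex_eq_iff, simp_all add: complex_of_vec_def)

lemma bounded_linear_vec_of_complex: "bounded_linear vec_of_complex"
  by (rule bounded_linear_intro[where K = 1])
     (simp_all add: vec_eq_iff forall_2, simp_all add: vec_of_complex_def)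

lemma mem_box_complex_of_vec:
  "complex_of_vec v \<in> box p q \<longleftrightarrow> v \<in> box (vec_of_complex p) (vec_of_complex q)"
  "complex_of_vec v \<in> cbox p q \<longleftrightarrow> v \<in> cbox (vec_of_complex p) (vec_of_complex q)"
  by (auto simp: complex_of_vec_def vec_of_complex_def mem_box_cart forall_2 in_box_complex_iff in_cbox_complex_iff)

text \<open>Change of variables with determinants lives on \<open>real^2\<close>, iterated
  integration on \<open>real \<times> real\<close>. The coordinate map \<open>g\<close> between them
  takes boxes to boxes of equal measure, so \<open>has_integral_twiddle\<close> applies with factor
  1, and Fubini for continuous integrands finishes.\<close>

lemma integral_cbox_vec_2:
  fixes f :: "complex \<Rightarrow> real"
  assumes "continuous_on (cbox p q) f"
  shows "integral (cbox (vec_of_complex p) (vec_of_complex q)) (\<lambda>v. f (complex_of_vec v))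
       = integral {Re p..Re q} (\<lambda>x. integral {Im p..Im q} (\<lambda>y. f (Complex x y)))"
proof -
  define F :: "real \<times> real \<Rightarrow> real" where "F = (\<lambda>(x, y). f (Complex x y))"
  define g :: "real^2 \<Rightarrow> real \<times> real" where "g = (\<lambda>v. (v $ 1, v $ 2))"
  define h :: "real \<times> real \<Rightarrow> real^2" where "h = (\<lambda>(x, y). vector [x, y])"
  have hg: "h (g v) = v" for v
    by (simp add: h_def g_def vec_eq_iff forall_2)
  have gh: "g (h v) = v" for v
    by (cases v) (simp add: h_def g_def)
  have g_cbox: "g ` cbox u v = cbox (g u) (g v)" for u v
  proof -
    have "x \<in> cbox u v \<longleftrightarrow> g x \<in> cbox (g u) (g v)" for x
      by (auto simp: g_def mem_box_cart forall_2 cbox_Pair_eq)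
    then have "y \<in> g ` cbox u v \<longleftrightarrow> y \<in> cbox (g u) (g v)" for y
      by (metis (no_types) gh imageE imageI)
    then show ?thesis by (rule set_eqI)
  qed
  have h_cbox: "h ` cbox u v = cbox (h u) (h v)" for u v
    using arg_cong[OF g_cbox[of "h u" "h v"], of "(`) h"] by (simp add: image_image hg gh)
  have cont: "continuous_on (cbox (g (vec_of_complex p)) (g (vec_of_complex q))) F"
    unfolding F_def case_prod_unfold
    by (rule continuous_on_compose2[OF assms])
       (auto simp: Complex_eq g_def vec_of_complex_def cbox_Pair_eq in_cbox_complex_iff
         intro!: continuous_intros)
  have "(F has_integral integral (cbox (g (vec_of_complex p)) (g (vec_of_complex q))) F)
          (cbox (g (vec_of_complex p)) (g (vec_of_complex q)))"
    using cont integrable_continuous by blast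
  then have "((\<lambda>v. F (g v)) has_integral (1 / 1) *\<^sub>R integral (cbox (g (vec_of_complex p)) (g (vec_of_complex q))) F)
     (h ` cbox (g (vec_of_complex p)) (g (vec_of_complex q)))"
  proof (rule has_integral_twiddle[rotated -1])
    show "continuous (at x) g" for x
      unfolding g_def by (intro continuous_intros)
    show "measure lborel (g ` cbox u v) = 1 * measure lborel (cbox u v)" for u v
    proof -
      have "(\<exists>i::2. P i) \<longleftrightarrow> P 1 \<or> P 2" for P by (metis exhaust_2)
      then show ?thesis
        unfolding g_cbox
        by (auto simp: g_def content_Pair content_cbox_if_cart interval_eq_empty_cart
             UNIV_2 content_real_if not_less)
    qed
    show "\<exists>w z. g ` cbox u v = cbox w z" "\<exists>w z. h ` cbox a b = cbox w z" for u v a b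
      using g_cbox h_cbox by blast+
  qed (simp_all only: hg gh zero_less_one)
  then have "integral (cbox (vec_of_complex p) (vec_of_complex q)) (\<lambda>v. F (g v)) =
        integral (cbox (g (vec_of_complex p)) (g (vec_of_complex q))) F"
    by (simp add: h_cbox hg integral_unique)
  also have "\<dots> = integral {Re p..Re q} (\<lambda>x. integral {Im p..Im q} (\<lambda>y. F (x, y)))"
    using integral_prod_continuous[of "Re p" "Im p" "Re q" "Im q" F] cont
    by (simp add: g_def vec_of_complex_def)
  finally show ?thesis
    by (simp add: F_def g_def complex_of_vec_def)
qed

text \<open>The left side is the area of the image of the box under G followed by w -> w - c
  \<open>cnj\<close> w: G has real Jacobian |G'|^2, the shear has determinant 1 - |c|^2, and |c| < 1
  keeps it injective. The image lies in a disc of radius R. Injectivity is asked on the open box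
  because opposite edges will be glued together by the exponential; the boundary has measure
  zero.\<close>

lemma area_sheared_holomorphic_image_le:
  assumes "open U" "G holomorphic_on U" "cbox p q \<subseteq> U" "inj_on G (box p q)"
    and c: "cmod c < 1" and "R \<ge> 0"
    and bound: "\<And>z. z \<in> box p q \<Longrightarrow> cmod (G z - c * cnj (G z)) \<le> R"
  shows "(1 - (cmod c)\<^sup>2) *
    integral {Re p..Re q} (\<lambda>x. integral {Im p..Im q} (\<lambda>y. (cmod (deriv G (Complex x y)))\<^sup>2)) \<le> pi * R\<^sup>2"
proof -
  define T where "T = (\<lambda>w. w - c * cnj w)"
  define F where "F = (\<lambda>v. vec_of_complex (T (G (complex_of_vec v))))"
  define F' where "F' = (\<lambda>v u. vec_of_complex (T (deriv G (complex_of_vec v) * complex_of_vec u)))"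
  define S where "S = box (vec_of_complex p) (vec_of_complex q)"
  interpret d: bounded_linear vec_of_complex by (rule bounded_linear_vec_of_complex)
  interpret e: bounded_linear complex_of_vec by (rule bounded_linear_complex_of_vec)
  have boxU: "complex_of_vec v \<in> U" if "v \<in> S" for v
    using that assms(3) box_subset_cbox unfolding S_def by (metis mem_box_complex_of_vec(1) subsetD)
  have injT: "inj T"
  proof (rule injI)
    fix x y assume "T x = T y"
    then have "x - y = c * cnj (x - y)"
      by (simp add: T_def algebra_simps)
    then have "cmod (x - y) = cmod c * cmod (x - y)"
      by (metis complex_mod_cnj norm_mult)
    then show "x = y" using c by auto
  qed
  have deriv: "(F has_derivative F' v) (at v within S)" if "v \<in> S" for v
  proof -
    have "(G has_field_derivative deriv G (complex_of_vec v)) (at (complex_of_vec v))"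
      using assms boxU[OF that] holomorphic_derivI by blast
    then have "(G has_derivative (*) (deriv G (complex_of_vec v))) (at (complex_of_vec v))"
      by (simp add: has_field_derivative_def)
    then have "((\<lambda>v. G (complex_of_vec v)) has_derivative
       (\<lambda>u. deriv G (complex_of_vec v) * complex_of_vec u)) (at v within S)"
      by (rule has_derivative_compose[OF e.has_derivative[OF has_derivative_ident]])
    then show ?thesis
      unfolding F_def F'_def T_def
      by (intro d.has_derivative derivative_intros has_derivative_cnj)
  qed
  have det: "\<bar>det (matrix (F' v))\<bar> = (1 - (cmod c)\<^sup>2) * (cmod (deriv G (complex_of_vec v)))\<^sup>2" for v
  proof -
    have "(cmod c)\<^sup>2 < 1" using c by (simp add: power_less_one_iff abs_square_less_1)
    moreover have "det (matrix (F' v)) = (1 - (cmod c)\<^sup>2) * (cmod (deriv G (complex_of_vec v)))\<^sup>2"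
      unfolding det_2 matrix_def F'_def cmod_power2
      by (simp add: T_def axis_def complex_of_vec_def vec_of_complex_def power2_eq_square algebra_simps)
    ultimately show ?thesis by simp
  qed
  have cont: "continuous_on (cbox p q) (\<lambda>z. (1 - (cmod c)\<^sup>2) * (cmod (deriv G z))\<^sup>2)"
    using holomorphic_deriv[OF assms(2,1)] assms(3)
    by (intro continuous_intros) (meson continuous_on_subset holomorphic_on_imp_continuous_on)
  have cont': "continuous_on (cbox (vec_of_complex p) (vec_of_complex q)) (\<lambda>v. \<bar>det (matrix (F' v))\<bar>)"
    unfolding det
    by (rule continuous_on_compose2[OF cont e.continuous_on[OF continuous_on_id]])
       (auto simp: mem_box_complex_of_vec)
  have inj: "inj_on F S"
  proof (rule inj_onI)
    fix x y assume "x \<in> S" "y \<in> S" "F x = F y"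
    then have "T (G (complex_of_vec x)) = T (G (complex_of_vec y))"
      unfolding F_def by (metis complex_of_vec_of_complex)
    then have "complex_of_vec x = complex_of_vec y"
      using \<open>x \<in> S\<close> \<open>y \<in> S\<close> inj_onD[OF assms(4)] injD[OF injT]
      unfolding S_def by (metis mem_box_complex_of_vec(1))
    then show "x = y" by (metis vec_of_complex_of_vec)
  qed
  have intS: "(\<lambda>v. \<bar>det (matrix (F' v))\<bar>) integrable_on S"
    unfolding S_def integrable_on_open_interval using cont' integrable_continuous by blast
  have S: "S \<in> sets lebesgue" by (simp add: S_def)
  have "integral {Re p..Re q} (\<lambda>x. integral {Im p..Im q} (\<lambda>y. (1 - (cmod c)\<^sup>2) * (cmod (deriv G (Complex x y)))\<^sup>2))
      = integral (cbox (vec_of_complex p) (vec_of_complex q)) (\<lambda>v. \<bar>det (matrix (F' v))\<bar>)"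
    unfolding det by (rule integral_cbox_vec_2[OF cont, symmetric])
  also have "\<dots> = integral S (\<lambda>v. \<bar>det (matrix (F' v))\<bar>)"
    by (simp add: S_def integral_open_interval)
  also have "\<dots> = measure lebesgue (F ` S)"
    using measure_differentiable_image_eq[OF S deriv inj intS] by simp
  also have "\<dots> \<le> measure lebesgue (cball (0::real^2) R)"
  proof (rule measure_mono_fmeasurable)
    show "F ` S \<subseteq> cball 0 R"
      using bound by (auto simp: F_def T_def S_def mem_box_complex_of_vec)
    show "F ` S \<in> sets lebesgue"
      using measurable_differentiable_image_eq[OF S deriv inj] intS by blast
  qed auto
  also have "\<dots> = pi * R\<^sup>2"
    using content_cball[OF \<open>R \<ge> 0\<close>, of "0 :: real^2"] by (simp add: unit_ball_vol_2)
  finally show ?thesis by simp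
qed

text \<open>A clopen argument in the exterior of the disc of radius R. There the open set
  \<open>V\<close> and the closed set \<open>W\<close> coincide, since the circle |z| = \<rho> is
  mapped into the disc; the pole makes \<open>V\<close> meet the exterior. By connectedness every
  exterior value is already taken inside |z| < \<rho>, so injectivity forbids it elsewhere. The
  hypotheses are topological because the sheared map is not holomorphic.\<close>

lemma norm_le_outside_of_injective_pole:
  fixes H :: "complex \<Rightarrow> complex"
  assumes cont: "continuous_on (ball 0 1 - {0}) H" and inj: "inj_on H (ball 0 1 - {0})"
    and pole: "filterlim H at_infinity (at 0)"
    and \<rho>: "0 < \<rho>" "\<rho> < 1" and bound: "\<And>z. cmod z = \<rho> \<Longrightarrow> cmod (H z) \<le> R"
    and z: "\<rho> \<le> cmod z" "cmod z < 1"
  shows "cmod (H z) \<le> R"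
proof (rule ccontr)
  assume "\<not> cmod (H z) \<le> R"
  then have zU: "H z \<in> - cball 0 R" by simp
  define V where "V = H ` (ball 0 \<rho> - {0})"
  define W where "W = H ` (cball 0 \<rho> - {0})"
  have nz: "\<rho> < cmod z" using z bound zU by (metis \<open>\<not> cmod (H z) \<le> R\<close> less_eq_real_def)
  have "open V"
    unfolding V_def using \<rho>
    by (intro invariance_of_domain continuous_on_subset[OF cont] inj_on_subset[OF inj]) auto
  have far: "\<exists>\<delta>>0. \<forall>x. x \<noteq> 0 \<and> cmod x < \<delta> \<longrightarrow> B \<le> cmod (H x)" for B
  proof -
    have "\<forall>\<^sub>F x in at 0. max B 1 \<le> cmod (H x)"
      using pole unfolding filterlim_at_infinity[OF order_refl]
      by (metis less_le_trans max.cobounded2 zero_less_one)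
    then show ?thesis
      unfolding eventually_at by (auto simp: dist_norm)
  qed
  \<comment> \<open>Values of modulus below \<open>cmod w + 1\<close> come only from \<delta> \<le>
    |x| \<le> \<rho>, so near a limit point \<open>w\<close> the set \<open>W\<close> is contained
    in the compact image \<open>K\<close> of a region that avoids the pole.\<close>
  have "closed W"
  proof -
    have "w \<in> W" if "w \<in> closure W" for w
    proof -
      obtain \<delta> where "\<delta> > 0" and \<delta>: "\<And>x. x \<noteq> 0 \<Longrightarrow> cmod x < \<delta> \<Longrightarrow> cmod w + 1 \<le> cmod (H x)"
        using far by meson
      define K where "K = H ` (cball 0 \<rho> - ball 0 \<delta>)"
      have "compact K"
        unfolding K_def using \<rho> \<open>\<delta> > 0\<close>
        by (intro compact_continuous_image continuous_on_subset[OF cont] compact_diff) auto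
      have "ball w 1 \<inter> W \<subseteq> K"
      proof
        fix u assume u: "u \<in> ball w 1 \<inter> W"
        then obtain x where x: "x \<in> cball 0 \<rho> - {0}" "u = H x" unfolding W_def by blast
        have "cmod u < cmod w + 1"
          using u norm_triangle_sub[of u w] by (auto simp: dist_norm norm_minus_commute)
        then have "\<not> cmod x < \<delta>" using \<delta>[of x] x by auto
        then show "u \<in> K" using x by (auto simp: K_def)
      qed
      moreover have "w \<in> closure (ball w 1 \<inter> W)"
        using open_Int_closure_subset[of "ball w 1" W] that by auto
      ultimately have "w \<in> K"
        by (metis \<open>compact K\<close> closure_closed closure_mono compact_imp_closed subsetD)
      then show "w \<in> W" using \<open>\<delta> > 0\<close> by (auto simp: K_def W_def)
    qed
    then show ?thesis by (metis closure_subset_eq subsetI)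
  qed
  have "V \<subseteq> W" by (auto simp: V_def W_def)
  have WV: "W \<inter> - cball 0 R \<subseteq> V"
    using bound by (force simp: V_def W_def less_eq_real_def)
  have conn: "connected (- cball (0::complex) R)"
    by (rule connected_complement_bounded_convex) auto
  obtain \<delta> where "\<delta> > 0" and \<delta>: "\<And>x. x \<noteq> 0 \<Longrightarrow> cmod x < \<delta> \<Longrightarrow> R + 1 \<le> cmod (H x)"
    using far by meson
  define x where "x = complex_of_real (min \<rho> \<delta> / 2)"
  have x: "x \<noteq> 0" "cmod x < \<rho>" "cmod x < \<delta>" using \<rho> \<open>\<delta> > 0\<close> by (auto simp: x_def norm_divide)
  have "H x \<in> V \<inter> - cball 0 R"
    using x \<delta>[of x] by (auto simp: V_def)
  moreover have "H z \<notin> V"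
  proof
    assume "H z \<in> V"
    then obtain y where y: "y \<in> ball 0 \<rho> - {0}" "H z = H y" unfolding V_def by blast
    moreover have "z \<noteq> 0" using z \<rho> by auto
    ultimately have "z = y" using inj_onD[OF inj, of z y] z \<rho> by auto
    then show False using y nz by auto
  qed
  moreover have "- cball 0 R \<subseteq> V \<union> - W" using WV by auto
  moreover have "V \<inter> - W \<inter> - cball 0 R = {}" using \<open>V \<subseteq> W\<close> by auto
  moreover have "H z \<in> - W" using WV zU \<open>H z \<notin> V\<close> by auto
  ultimately show False
    using connectedD[OF conn \<open>open V\<close> open_Compl[OF \<open>closed W\<close>]] zU by auto
qed

section \<open>The area theorem\<close>

lemma has_integral_circle_mean:
  assumes "A holomorphic_on ball 0 1" "0 < s" "s < 1"
  shows "((\<lambda>t. A (of_real s * exp (2 * of_real pi * \<i> * of_real t))) has_integral A 0) {0..1}"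
proof -
  have "A holomorphic_on cball 0 s"
    using assms by (intro holomorphic_on_subset[OF assms(1)]) auto
  then have "((\<lambda>u. A u / (u - 0)) has_contour_integral 2 * of_real pi * \<i> * A 0) (circlepath 0 s)"
    using assms by (intro Cauchy_integral_circlepath_simple) auto
  then have "((\<lambda>t. A (of_real s * exp (2 * of_real pi * \<i> * of_real t)) * (2 * of_real pi * \<i>))
               has_integral 2 * of_real pi * \<i> * A 0) {0..1}"
    unfolding has_contour_integral
    by (rule has_integral_eq[rotated])
       (use assms in \<open>simp add: vector_derivative_circlepath, simp add: circlepath\<close>)
  from has_integral_mult_left[OF this, of "1 / (2 * of_real pi * \<i>)"] show ?thesis
    by simp
qed

text \<open>Bessel's inequality for z g'(z) with g = 1/z + h: its expansion is -1/z + b z plus the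
  remainder z k(z), which starts at z^2 and is orthogonal on the circle to the two leading
  terms.\<close>

lemma circle_mean_square_ge:
  fixes h :: "complex \<Rightarrow> complex"
  assumes h: "h holomorphic_on ball 0 1" and s: "0 < s" "s < 1"
  defines "e \<equiv> (\<lambda>t. of_real s * exp (2 * of_real pi * \<i> * of_real t) :: complex)"
  shows "1 / s\<^sup>2 + (cmod (deriv h 0))\<^sup>2 * s\<^sup>2
      \<le> integral {0..1} (\<lambda>t. (cmod (- 1 / e t + e t * deriv h (e t)))\<^sup>2)"
proof -
  define b where "b = deriv h 0"
  define k where "k = (\<lambda>z. deriv h z - b)"
  \<comment> \<open>With \<open>E = - 1 / z + b z\<close>, on \<open>|z| = s\<close> the identity \<open>cnj z = s\<^sup>2 / z\<close> turns the cross terms of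
    \<open>|z k + E|\<^sup>2\<close> into the real part of the holomorphic function \<open>A\<close>, whose mean is \<open>A 0 = 0\<close>.\<close>
  define A where "A = (\<lambda>z. - 2 * b * z\<^sup>2 / of_real (s\<^sup>2) + 2 * k z * (cnj b * of_real (s\<^sup>2) - z\<^sup>2 / of_real (s\<^sup>2)))"
  have dh: "deriv h holomorphic_on ball 0 1"
    using h by (intro holomorphic_deriv) auto
  have e: "cmod (e t) = s" for t
    using s by (simp add: e_def norm_mult)
  have "A holomorphic_on ball 0 1"
    unfolding A_def k_def by (intro holomorphic_intros dh) (use s in auto)
  from has_integral_circle_mean[OF this s] have "((\<lambda>t. A (e t)) has_integral 0) {0..1}"
    by (simp add: A_def k_def b_def e_def)
  from has_integral_linear[OF this bounded_linear_Re]
  have "((\<lambda>t. Re (A (e t))) has_integral 0) {0..1}"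
    by (simp add: o_def)
  from has_integral_add[OF has_integral_const_real[of "1 / s\<^sup>2 + (cmod b)\<^sup>2 * s\<^sup>2" 0 1] this]
  have "((\<lambda>t. 1 / s\<^sup>2 + (cmod b)\<^sup>2 * s\<^sup>2 + Re (A (e t))) has_integral (1 / s\<^sup>2 + (cmod b)\<^sup>2 * s\<^sup>2)) {0..1}"
    by simp
  moreover have "continuous_on {0..1} (\<lambda>t. (cmod (- 1 / e t + e t * deriv h (e t)))\<^sup>2)"
  proof -
    have ce: "continuous_on {0..1} e" unfolding e_def by (intro continuous_intros)
    have "continuous_on {0..1} (\<lambda>t. deriv h (e t))"
      by (rule continuous_on_compose2[OF holomorphic_on_imp_continuous_on[OF dh] ce]) (use e s in auto)
    then show ?thesis
      using e s by (intro continuous_intros ce) (metis norm_zero less_irrefl)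
  qed
  moreover have "1 / s\<^sup>2 + (cmod b)\<^sup>2 * s\<^sup>2 + Re (A z) \<le> (cmod (- 1 / z + z * deriv h z))\<^sup>2" if z: "cmod z = s" for z
  proof -
    define E where "E = - 1 / z + b * z"
    have zz: "z * cnj z = of_real (s\<^sup>2)" using z by (metis complex_norm_square)
    have nz: "z \<noteq> 0" using z s by auto
    have cz: "cnj z = of_real (s\<^sup>2) / z" using zz nz by (simp add: field_simps)
    have cE: "cnj E = - z / of_real (s\<^sup>2) + cnj b * of_real (s\<^sup>2) / z"
      using nz s by (simp add: E_def cz)
    have sq: "(cmod (u + v))\<^sup>2 = (cmod u)\<^sup>2 + (cmod v)\<^sup>2 + 2 * Re (cnj u * v)" for u v
      unfolding cmod_power2 by (simp add: power2_eq_square algebra_simps)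
    have "(cmod E)\<^sup>2 = 1 / s\<^sup>2 + (cmod b)\<^sup>2 * s\<^sup>2 - 2 * Re (b * z\<^sup>2 / of_real (s\<^sup>2))"
    proof -
      have "(cmod E)\<^sup>2 = (cmod (- 1 / z))\<^sup>2 + (cmod (b * z))\<^sup>2 + 2 * Re (cnj (- 1 / z) * (b * z))"
        unfolding E_def by (rule sq)
      moreover have "cnj (- 1 / z) * (b * z) = - (b * z\<^sup>2 / of_real (s\<^sup>2))"
        using nz s by (simp add: cz power2_eq_square)
      ultimately show ?thesis
        using z by (simp add: norm_mult norm_divide power_divide power_mult_distrib)
    qed
    moreover have "(cmod (- 1 / z + z * deriv h z))\<^sup>2
        = (cmod (z * k z))\<^sup>2 + (cmod E)\<^sup>2 + 2 * Re (z * k z * cnj E)"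
    proof -
      have "- 1 / z + z * deriv h z = z * k z + E" by (simp add: k_def E_def algebra_simps)
      then show ?thesis using sq[of "z * k z" E] by (simp add: algebra_simps)
    qed
    moreover have "z * k z * cnj E = k z * (cnj b * of_real (s\<^sup>2) - z\<^sup>2 / of_real (s\<^sup>2))"
      unfolding cE using nz by (simp add: field_simps power2_eq_square)
    moreover have "A z = 2 * (k z * (cnj b * of_real (s\<^sup>2) - z\<^sup>2 / of_real (s\<^sup>2))) - 2 * (b * z\<^sup>2 / of_real (s\<^sup>2))"
      by (simp add: A_def)
    moreover have "Re (2 * u - 2 * v) = 2 * Re u - 2 * Re v" for u v :: complex
      by simp
    \<comment> \<open>The only loss is the discarded square
      \<open>(cmod (z * k z))\<^sup>2\<close>.\<close>
    ultimately show ?thesis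
      by (smt (verit) zero_le_power2)
  qed
  ultimately show ?thesis
    unfolding b_def[symmetric] using e
    by (intro has_integral_le[OF _ integrable_integral[OF integrable_continuous_real]]) auto
qed

lemma filterlim_norm_minus_scaled_cnj:
  fixes g :: "'a \<Rightarrow> complex"
  assumes "filterlim g at_infinity F" "cmod c < 1"
  shows "filterlim (\<lambda>z. g z - c * cnj (g z)) at_infinity F"
proof (rule filterlim_norm_at_top_imp_at_infinity)
  have "filterlim (\<lambda>z. (1 - cmod c) * cmod (g z)) at_top F"
    using assms by (intro filterlim_tendsto_pos_mult_at_top[OF tendsto_const]
       filterlim_at_infinity_imp_norm_at_top) auto
  then show "filterlim (\<lambda>z. cmod (g z - c * cnj (g z))) at_top F"
  proof (rule filterlim_at_top_mono, intro always_eventually allI)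
    fix z
    show "(1 - cmod c) * cmod (g z) \<le> cmod (g z - c * cnj (g z))"
      using norm_triangle_ineq2[of "g z" "c * cnj (g z)"] by (simp add: norm_mult algebra_simps)
  qed
qed

text \<open>Under z = exp (2 pi \<zeta>) the annulus \<rho> < |z| < r, slit along the positive axis,
  is the open rectangle a < Re \<zeta> < b, 0 < Im \<zeta> < 1, and G'(\<zeta>) = 2 pi z g'(z).
  Vertical segments become circles, so the inner integrals are the circle means bounded above. The
  containing disc comes from the pole lemma applied to the sheared map \<open>H\<close>, and a
  factor pi cancels at the end.\<close>

lemma area_inequality:
  fixes h :: "complex \<Rightarrow> complex"
  assumes h: "h holomorphic_on ball 0 1" and inj: "inj_on (\<lambda>z. 1 / z + h z) (ball 0 1 - {0})"
    and \<rho>: "0 < \<rho>" "\<rho> < r" "r < 1" and c: "cmod c < 1" and "R \<ge> 0"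
    and bound: "\<And>z. cmod z = \<rho> \<Longrightarrow> cmod ((1 / z + h z) - c * cnj (1 / z + h z)) \<le> R"
  shows "(1 - (cmod c)\<^sup>2) * (1 / \<rho>\<^sup>2 - 1 / r\<^sup>2 + (cmod (deriv h 0))\<^sup>2 * (r\<^sup>2 - \<rho>\<^sup>2)) \<le> R\<^sup>2"
proof -
  define g where "g = (\<lambda>z. 1 / z + h z)"
  define H where "H = (\<lambda>z. g z - c * cnj (g z))"
  define G where "G = (\<lambda>\<zeta>. g (exp (2 * of_real pi * \<zeta>)))"
  define B where "B = (cmod (deriv h 0))\<^sup>2"
  define K where "K = (\<lambda>z. - 1 / z + z * deriv h z)"
  define a where "a = ln \<rho> / (2 * pi)"
  define b where "b = ln r / (2 * pi)"
  have ab: "a < b" "b < 0"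
    using \<rho> by (simp_all add: a_def b_def divide_strict_right_mono divide_neg_pos)
  have exp_a: "exp (2 * pi * a) = \<rho>" and exp_b: "exp (2 * pi * b) = r"
    using \<rho> by (simp_all add: a_def b_def)
  have norm_exp: "cmod (exp (2 * of_real pi * \<zeta>)) = exp (2 * pi * Re \<zeta>)" for \<zeta>
    by simp
  have U: "cmod (exp (2 * of_real pi * \<zeta>)) < 1" if "Re \<zeta> < 0" for \<zeta>
    using that by (simp add: mult_pos_neg)
  have hg: "g holomorphic_on ball 0 1 - {0}"
    unfolding g_def by (intro holomorphic_intros holomorphic_on_subset[OF h]) auto
  have Hbound: "cmod (H z) \<le> R" if "\<rho> \<le> cmod z" "cmod z < 1" for z
  proof (rule norm_le_outside_of_injective_pole[of H \<rho>])
    show "continuous_on (ball 0 1 - {0}) H"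
      unfolding H_def by (intro continuous_intros holomorphic_on_imp_continuous_on hg)
    show "inj_on H (ball 0 1 - {0})"
    proof (rule inj_onI)
      fix x y assume xy: "x \<in> ball 0 1 - {0}" "y \<in> ball 0 1 - {0}" "H x = H y"
      then have "g x - g y = c * cnj (g x - g y)"
        by (simp add: H_def algebra_simps)
      then have "cmod (g x - g y) = cmod c * cmod (g x - g y)"
        by (metis complex_mod_cnj norm_mult)
      then have "g x = g y" using c by auto
      then show "x = y" using inj_onD[OF inj _ xy(1,2)] by (simp add: g_def)
    qed
    have "(h \<longlongrightarrow> h 0) (at 0)"
      using h by (metis centre_in_ball continuous_on_eq_continuous_at holomorphic_on_imp_continuous_on
          isCont_def open_ball zero_less_one)
    then have "filterlim g at_infinity (at 0)"
      unfolding g_def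
      by (subst add.commute, intro tendsto_add_filterlim_at_infinity[of h "h 0"])
         (auto simp: divide_inverse filterlim_inverse_at_infinity)
    then show "filterlim H at_infinity (at 0)"
      unfolding H_def using c by (rule filterlim_norm_minus_scaled_cnj)
  qed (use \<rho> that bound in \<open>auto simp: H_def g_def\<close>)
  have derivG: "deriv G \<zeta> = 2 * of_real pi * K (exp (2 * of_real pi * \<zeta>))" if "Re \<zeta> < 0" for \<zeta>
  proof -
    define z where "z = exp (2 * of_real pi * \<zeta>)"
    have "(h has_field_derivative deriv h z) (at z)"
      using U[OF that] by (intro holomorphic_derivI[OF h]) (auto simp: z_def)
    have "z \<noteq> 0" by (simp add: z_def)
    with \<open>(h has_field_derivative deriv h z) (at z)\<close> have "(g has_field_derivative ((0 * z - 1 * 1) / (z * z) + deriv h z)) (at z)"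
      unfolding g_def by (intro DERIV_add DERIV_divide DERIV_const DERIV_ident)
    then have "(g has_field_derivative (- 1 / z\<^sup>2 + deriv h z)) (at z)"
      by (simp add: power2_eq_square)
    then have "(G has_field_derivative ((- 1 / z\<^sup>2 + deriv h z) * (2 * of_real pi * z))) (at \<zeta>)"
      unfolding G_def z_def
      by (intro DERIV_chain2[where f = g]) (auto intro!: derivative_eq_intros simp: algebra_simps)
    moreover have "(- 1 / z\<^sup>2 + deriv h z) * (2 * of_real pi * z) = 2 * of_real pi * K z"
      using \<open>z \<noteq> 0\<close> by (simp add: K_def power2_eq_square field_simps)
    ultimately show ?thesis
      using DERIV_imp_deriv z_def by metis
  qed
  have holG: "G holomorphic_on {\<zeta>. Re \<zeta> < 0}"
  proof -
    have "(\<lambda>\<zeta>. exp (2 * of_real pi * \<zeta>)) holomorphic_on {\<zeta>. Re \<zeta> < 0}"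
      by (intro holomorphic_intros)
    moreover have "(\<lambda>\<zeta>. exp (2 * of_real pi * \<zeta>)) ` {\<zeta>. Re \<zeta> < 0} \<subseteq> ball 0 1 - {0}"
      using U by (auto simp: dist_norm simp del: norm_exp_eq_Re)
    ultimately show ?thesis
      using holomorphic_on_compose_gen[OF _ hg] unfolding G_def o_def by blast
  qed
  have area: "(1 - (cmod c)\<^sup>2) *
    integral {Re (Complex a 0)..Re (Complex b 1)} (\<lambda>x. integral {Im (Complex a 0)..Im (Complex b 1)}
        (\<lambda>y. (cmod (deriv G (Complex x y)))\<^sup>2)) \<le> pi * R\<^sup>2"
  proof (rule area_sheared_holomorphic_image_le[of "{\<zeta>. Re \<zeta> < 0}"])
    show "G holomorphic_on {\<zeta>. Re \<zeta> < 0}" by (rule holG)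
    show "cbox (Complex a 0) (Complex b 1) \<subseteq> {\<zeta>. Re \<zeta> < 0}"
      using ab by (auto simp: in_cbox_complex_iff)
    show "inj_on G (box (Complex a 0) (Complex b 1))"
    proof (rule inj_onI)
      fix x y assume xy: "x \<in> box (Complex a 0) (Complex b 1)" "y \<in> box (Complex a 0) (Complex b 1)" "G x = G y"
      then have "Re x < 0" "Re y < 0" using ab by (auto simp: in_box_complex_iff)
      then have "exp (2 * of_real pi * x) \<in> ball 0 1 - {0}" "exp (2 * of_real pi * y) \<in> ball 0 1 - {0}"
        using U by (auto simp: dist_norm simp del: norm_exp_eq_Re)
      moreover have "1 / exp (2 * of_real pi * x) + h (exp (2 * of_real pi * x))
          = 1 / exp (2 * of_real pi * y) + h (exp (2 * of_real pi * y))"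
        using xy(3) by (simp add: G_def g_def)
      ultimately have "exp (2 * of_real pi * x) = exp (2 * of_real pi * y)"
        using inj_onD[OF inj] by blast
      moreover have "\<bar>Im x - Im y\<bar> < 1" using xy by (auto simp: in_box_complex_iff)
      then have "\<bar>Im (2 * of_real pi * x) - Im (2 * of_real pi * y)\<bar> < 2 * pi"
        by (simp add: abs_mult flip: right_diff_distrib)
      ultimately have "2 * of_real pi * x = 2 * of_real pi * y"
        by (rule exp_complex_eqI[rotated])
      then show "x = y" by simp
    qed
    show "cmod (G \<zeta> - c * cnj (G \<zeta>)) \<le> R" if "\<zeta> \<in> box (Complex a 0) (Complex b 1)" for \<zeta>
    proof -
      have "a < Re \<zeta>" "Re \<zeta> < 0" using that ab by (auto simp: in_box_complex_iff)
      then have "\<rho> \<le> cmod (exp (2 * of_real pi * \<zeta>))"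
        unfolding norm_exp exp_a[symmetric] by simp
      then show ?thesis
        using Hbound U[OF \<open>Re \<zeta> < 0\<close>] by (simp add: H_def G_def)
    qed
  qed (use c \<open>R \<ge> 0\<close> in \<open>auto simp: open_halfspace_Re_lt\<close>)
  define I where "I = (\<lambda>x. integral {0..1} (\<lambda>y. (cmod (deriv G (Complex x y)))\<^sup>2))"
  \<comment> \<open>The segment Re \<zeta> = x is the circle of radius s = exp (2 pi x), so 1/s^2
    and s^2 turn into the two exponentials.\<close>
  have I_ge: "4 * pi\<^sup>2 * (exp (- 4 * pi * x) + B * exp (4 * pi * x)) \<le> I x" if "x \<in> {a..b}" for x
  proof -
    have x: "x < 0" using that ab by auto
    define s where "s = exp (2 * pi * x)"
    have s: "0 < s" "s < 1" using x by (auto simp: s_def mult_pos_neg)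
    have *: "exp (2 * of_real pi * Complex x y) = of_real s * exp (2 * of_real pi * \<i> * of_real y)" for y
      by (simp add: s_def Complex_eq algebra_simps flip: exp_add exp_of_real)
    have "I x = integral {0..1} (\<lambda>y. (cmod (2 * of_real pi * K (of_real s * exp (2 * of_real pi * \<i> * of_real y))))\<^sup>2)"
      unfolding I_def by (intro integral_cong) (simp only: derivG x complex.sel *)
    also have "\<dots> = 4 * pi\<^sup>2 * integral {0..1} (\<lambda>y. (cmod (K (of_real s * exp (2 * of_real pi * \<i> * of_real y))))\<^sup>2)"
      by (simp add: norm_mult power_mult_distrib)
    also have "\<dots> \<ge> 4 * pi\<^sup>2 * (1 / s\<^sup>2 + B * s\<^sup>2)"
      using circle_mean_square_ge[OF h s] unfolding K_def B_def
      by (intro mult_left_mono) auto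
    moreover have "s\<^sup>2 = exp (4 * pi * x)"
      by (simp add: s_def power2_eq_square flip: exp_add)
    ultimately show ?thesis by (simp add: exp_minus divide_inverse)
  qed
  have "continuous_on (cbox a b) I"
    unfolding I_def cbox_interval[symmetric]
  proof (rule integral_continuous_on_param)
    have "continuous_on {\<zeta>. Re \<zeta> < 0} (deriv G)"
      by (intro holomorphic_on_imp_continuous_on holomorphic_deriv holG open_halfspace_Re_lt)
    then have "continuous_on (cbox a b \<times> cbox 0 1) (\<lambda>p. deriv G (Complex (fst p) (snd p)))"
      by (rule continuous_on_compose2) (use ab in \<open>auto simp: Complex_eq intro!: continuous_intros\<close>)
    then show "continuous_on (cbox a b \<times> cbox 0 1) (\<lambda>(x, y). (cmod (deriv G (Complex x y)))\<^sup>2)"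
      unfolding case_prod_unfold by (intro continuous_intros)
  qed
  then have I_int: "(I has_integral integral {a..b} I) {a..b}"
    using integrable_continuous_real integrable_integral by (metis cbox_interval)
  \<comment> \<open>An antiderivative is pi (B exp (4 pi x) - exp (-4 pi x)); at the endpoints exp
    (4 pi x) equals \<rho>^2 and r^2.\<close>
  have "((\<lambda>x. 4 * pi\<^sup>2 * (exp (- 4 * pi * x) + B * exp (4 * pi * x))) has_integral
     (pi * (B * exp (4 * pi * b) - exp (- 4 * pi * b)) - pi * (B * exp (4 * pi * a) - exp (- 4 * pi * a)))) {a..b}"
    using ab
    by (intro fundamental_theorem_of_calculus)
       (auto intro!: derivative_eq_intros simp flip: has_real_derivative_iff_has_vector_derivative
         simp: algebra_simps power2_eq_square)
  then have "pi * (B * exp (4 * pi * b) - exp (- 4 * pi * b)) - pi * (B * exp (4 * pi * a) - exp (- 4 * pi * a))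
       \<le> integral {a..b} I"
    using I_ge by (intro has_integral_le[OF _ I_int]) auto
  moreover have "exp (4 * pi * a) = \<rho>\<^sup>2" "exp (4 * pi * b) = r\<^sup>2"
    by (simp_all add: power2_eq_square flip: exp_a exp_b exp_add)
  then have "exp (- 4 * pi * a) = 1 / \<rho>\<^sup>2" "exp (- 4 * pi * b) = 1 / r\<^sup>2"
       "exp (4 * pi * a) = \<rho>\<^sup>2" "exp (4 * pi * b) = r\<^sup>2"
    by (simp_all add: exp_minus divide_inverse)
  ultimately have "pi * (1 / \<rho>\<^sup>2 - 1 / r\<^sup>2 + B * (r\<^sup>2 - \<rho>\<^sup>2)) \<le> integral {a..b} I"
    by (simp add: algebra_simps)
  moreover have "0 \<le> 1 - (cmod c)\<^sup>2" using c by (simp add: power_le_one)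
  ultimately have "(1 - (cmod c)\<^sup>2) * (pi * (1 / \<rho>\<^sup>2 - 1 / r\<^sup>2 + B * (r\<^sup>2 - \<rho>\<^sup>2))) \<le> (1 - (cmod c)\<^sup>2) * integral {a..b} I"
    by (rule mult_left_mono)
  also have "\<dots> \<le> pi * R\<^sup>2" using area by (simp add: I_def)
  finally have "pi * ((1 - (cmod c)\<^sup>2) * (1 / \<rho>\<^sup>2 - 1 / r\<^sup>2 + B * (r\<^sup>2 - \<rho>\<^sup>2))) \<le> pi * R\<^sup>2"
    by (simp add: mult_ac)
  then show ?thesis by (simp add: B_def)
qed

theorem area_theorem:
  fixes h :: "complex \<Rightarrow> complex"
  assumes h: "h holomorphic_on ball 0 1" and inj: "inj_on (\<lambda>z. 1 / z + h z) (ball 0 1 - {0})"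
  shows "cmod (deriv h 0) \<le> 1"
proof -
  define b where "b = deriv h 0"
  define B where "B = (cmod b)\<^sup>2"
  \<comment> \<open>Translating the image so that the constant term vanishes keeps univalence and
    the derivative at 0. A nonzero constant term would add a constant to R, hence a term of order
    1/\<rho> to R^2, and the limit would be lost.\<close>
  define h1 where "h1 = (\<lambda>z. h z - h 0)"
  have h1: "h1 holomorphic_on ball 0 1" and inj1: "inj_on (\<lambda>z. 1 / z + h1 z) (ball 0 1 - {0})"
    using h inj by (auto simp: h1_def inj_on_def intro!: holomorphic_intros)
  have der: "(h has_field_derivative deriv h z) (at z)"
            "(deriv h has_field_derivative deriv (deriv h) z) (at z)" if "z \<in> ball 0 1" for z
    using that h by (auto intro!: holomorphic_derivI holomorphic_deriv)
  have "(h1 has_field_derivative b) (at 0)"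
    unfolding h1_def b_def by (auto intro!: derivative_eq_intros der)
  then have dh1: "deriv h1 0 = b" by (rule DERIV_imp_deriv)
  have "compact (deriv (deriv h) ` cball 0 (1/2))"
  proof (intro compact_continuous_image holomorphic_on_imp_continuous_on compact_cball)
    have "deriv (deriv h) holomorphic_on ball 0 1"
      using h by (intro holomorphic_deriv) auto
    then show "deriv (deriv h) holomorphic_on cball 0 (1/2)"
      by (rule holomorphic_on_subset) auto
  qed
  then have "bounded (deriv (deriv h) ` cball 0 (1/2))" by (rule compact_imp_bounded)
  then obtain C where "\<forall>y \<in> deriv (deriv h) ` cball 0 (1/2). cmod y \<le> C"
    unfolding bounded_iff by blast
  then have C: "cmod (deriv (deriv h) z) \<le> C" if "z \<in> cball 0 (1/2)" for z
    using that by blast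
  have taylor: "cmod (h1 z - b * z) \<le> C * (cmod z)\<^sup>2" if z: "z \<in> cball 0 (1/2)" for z
  proof -
    have "cmod ((deriv ^^ 0) h z - (\<Sum>i\<le>1. (deriv ^^ i) h 0 * (z - 0) ^ i / fact i))
        \<le> C * cmod (z - 0) ^ Suc 1 / fact 1"
    proof (rule complex_Taylor[of "cball 0 (1/2)" 1 "\<lambda>i. (deriv ^^ i) h"])
      fix i :: nat and x :: complex assume "x \<in> cball 0 (1/2)" "i \<le> 1"
      then have "i = 0 \<or> i = 1" "x \<in> ball 0 1" by auto
      then show "((deriv ^^ i) h has_field_derivative (deriv ^^ Suc i) h x) (at x within cball 0 (1/2))"
        using der[of x] by (auto intro: has_field_derivative_at_within)
    qed (use C z in auto)
    then show ?thesis
      by (simp add: h1_def b_def numeral_2_eq_2 algebra_simps)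
  qed
  have "0 \<le> C" using order_trans[OF norm_ge_zero C[of 0]] by simp
  have B0: "0 \<le> B" by (simp add: B_def)
  have Br: "B * r\<^sup>2 - 1 / r\<^sup>2 \<le> 0" if r: "0 < r" "r < 1" for r :: real
  proof -
    \<comment> \<open>This is the area inequality, right side moved to the left, after 1/\<rho>^2
      has cancelled. It is polynomial in \<rho>, so its limit at 0 is found by substitution; the
      term -B \<rho>^2 is what the shear's Jacobian takes from 1/\<rho>^2.\<close>
    define q where "q = (\<lambda>\<rho>::real. - B * \<rho>\<^sup>2 + (1 - B * \<rho> ^ 4) * (B * (r\<^sup>2 - \<rho>\<^sup>2) - 1 / r\<^sup>2) - 4 * C * \<rho> - 4 * C\<^sup>2 * \<rho> ^ 4)"
    have "q \<rho> \<le> 0" if \<rho>: "0 < \<rho>" "\<rho> < r" "\<rho> \<le> 1 / 2" and small: "cmod b * \<rho>\<^sup>2 < 1" for \<rho>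
    proof -
      \<comment> \<open>On |z| = \<rho> the conjugate of 1/z is z / \<rho>^2, so this coefficient
        makes c \<open>cnj\<close> (1/z) equal to b z, and the linear term cancels. What remains is
        \<open>cnj\<close> z (1/\<rho>^2 - B \<rho>^2), of modulus at most 1/\<rho>, and two Taylor
        errors of size at most C \<rho>^2 each; hence the value of \<open>R\<close>.\<close>
      define c where "c = b * of_real (\<rho>\<^sup>2)"
      define R where "R = 1 / \<rho> + 2 * C * \<rho>\<^sup>2"
      have c: "cmod c = cmod b * \<rho>\<^sup>2" by (simp add: c_def norm_mult norm_power)
      have bd: "cmod ((1 / z + h1 z) - c * cnj (1 / z + h1 z)) \<le> R" if z: "cmod z = \<rho>" for z
      proof -
        define e where "e = h1 z - b * z"
        have e: "cmod e \<le> C * \<rho>\<^sup>2" using taylor[of z] z \<rho> by (simp add: e_def)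
        have zz: "z * cnj z = of_real (\<rho>\<^sup>2)" using z by (metis complex_norm_square)
        have nz: "z \<noteq> 0" using z \<rho> by auto
        have iz: "1 / z = cnj z / of_real (\<rho>\<^sup>2)" using zz nz \<rho> by (simp add: field_simps)
        have icz: "c * (1 / cnj z) = b * z" using zz nz \<rho> by (simp add: c_def field_simps)
        have bb: "b * cnj b = of_real B" unfolding B_def by (metis complex_norm_square)
        have "(1 / z + h1 z) - c * cnj (1 / z + h1 z)
            = 1 / z + (b * z + e) - c * (1 / cnj z) - c * (cnj b * cnj z) - c * cnj e"
          by (simp add: e_def algebra_simps)
        also have "\<dots> = cnj z * (1 / of_real (\<rho>\<^sup>2) - b * cnj b * of_real (\<rho>\<^sup>2)) + (e - c * cnj e)"
          unfolding icz iz by (simp add: c_def algebra_simps)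
        also have "\<dots> = cnj z * of_real (1 / \<rho>\<^sup>2 - B * \<rho>\<^sup>2) + (e - c * cnj e)"
          by (simp add: bb)
        finally have eq: "(1 / z + h1 z) - c * cnj (1 / z + h1 z) = \<dots>" .
        \<comment> \<open>The condition |c| < 1 gives 1/\<rho>^2 - B \<rho>^2 its sign, so that its
          modulus is itself and dropping B \<rho>^2 only enlarges it.\<close>
        have "(cmod b * \<rho>\<^sup>2)\<^sup>2 \<le> 1" using small by (intro power_le_one) auto
        then have "B * \<rho>\<^sup>2 \<le> 1 / \<rho>\<^sup>2" using \<rho> by (simp add: B_def field_simps power2_eq_square)
        then have "cmod (cnj z * of_real (1 / \<rho>\<^sup>2 - B * \<rho>\<^sup>2)) = \<rho> * (1 / \<rho>\<^sup>2 - B * \<rho>\<^sup>2)"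
          unfolding norm_mult norm_of_real using z by simp
        also have "\<dots> \<le> \<rho> * (1 / \<rho>\<^sup>2)" using \<rho> B0 by (intro mult_left_mono) auto
        also have "\<dots> = 1 / \<rho>" using \<rho> by (simp add: power2_eq_square)
        finally have 1: "cmod (cnj z * of_real (1 / \<rho>\<^sup>2 - B * \<rho>\<^sup>2)) \<le> 1 / \<rho>" .
        have "cmod (e - c * cnj e) \<le> cmod e + cmod c * cmod e"
          by (metis complex_mod_cnj norm_mult norm_triangle_ineq4)
        also have "\<dots> \<le> cmod e + 1 * cmod e"
          using small c by (intro add_left_mono mult_right_mono) auto
        finally have "cmod (e - c * cnj e) \<le> 2 * C * \<rho>\<^sup>2" using e by simp
        with 1 show ?thesis
          unfolding eq R_def by (rule norm_triangle_mono)
      qed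
      have "(1 - (cmod c)\<^sup>2) * (1 / \<rho>\<^sup>2 - 1 / r\<^sup>2 + (cmod (deriv h1 0))\<^sup>2 * (r\<^sup>2 - \<rho>\<^sup>2)) \<le> R\<^sup>2"
        using area_inequality[OF h1 inj1 \<rho>(1,2) r(2) _ _ bd] small c \<rho> \<open>0 \<le> C\<close>
        by (simp add: R_def)
      then have "(1 - B * \<rho> ^ 4) * (1 / \<rho>\<^sup>2 - 1 / r\<^sup>2 + B * (r\<^sup>2 - \<rho>\<^sup>2)) - R\<^sup>2 \<le> 0"
        by (simp add: dh1 c B_def power_mult_distrib)
      also have "(1 - B * \<rho> ^ 4) * (1 / \<rho>\<^sup>2 - 1 / r\<^sup>2 + B * (r\<^sup>2 - \<rho>\<^sup>2)) - R\<^sup>2 = q \<rho>"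
      proof -
        have i: "\<rho> ^ 4 * (1 / \<rho>\<^sup>2) = \<rho>\<^sup>2" using \<rho> by (simp add: power2_eq_square power4_eq_xxxx)
        have j: "1 / \<rho> * \<rho>\<^sup>2 = \<rho>" using \<rho> by (simp add: power2_eq_square)
        have "(1 - B * \<rho> ^ 4) * (1 / \<rho>\<^sup>2 - 1 / r\<^sup>2 + B * (r\<^sup>2 - \<rho>\<^sup>2))
          = 1 / \<rho>\<^sup>2 - B * (\<rho> ^ 4 * (1 / \<rho>\<^sup>2)) + (1 - B * \<rho> ^ 4) * (B * (r\<^sup>2 - \<rho>\<^sup>2) - 1 / r\<^sup>2)"
          by (simp add: algebra_simps)
        moreover have "R\<^sup>2 = 1 / \<rho>\<^sup>2 + 4 * C * (1 / \<rho> * \<rho>\<^sup>2) + 4 * C\<^sup>2 * \<rho> ^ 4"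
          unfolding R_def power2_sum by (simp add: power_divide power_mult_distrib)
        ultimately show ?thesis unfolding i j q_def by simp
      qed
      finally show ?thesis .
    qed
    moreover have "\<forall>\<^sub>F \<rho> in at_right 0. 0 < \<rho> \<and> \<rho> < r \<and> \<rho> \<le> 1 / 2 \<and> cmod b * \<rho>\<^sup>2 < 1"
    proof (intro eventually_conj)
      have "((\<lambda>\<rho>. cmod b * \<rho>\<^sup>2) \<longlongrightarrow> cmod b * 0\<^sup>2) (at_right 0)"
        by (intro tendsto_intros)
      then show "\<forall>\<^sub>F \<rho> in at_right 0. cmod b * \<rho>\<^sup>2 < 1"
        by (rule order_tendstoD) simp
      show "\<forall>\<^sub>F \<rho> in at_right 0. \<rho> \<le> 1 / (2::real)"
        using eventually_at_right_real[of 0 "1/2"] by (auto elim!: eventually_mono)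
      show "\<forall>\<^sub>F \<rho> in at_right 0. \<rho> < r"
        using eventually_at_right_real[of 0 r] r by (auto elim!: eventually_mono)
    qed (simp add: eventually_at_right_less)
    ultimately have ev: "\<forall>\<^sub>F \<rho> in at_right 0. q \<rho> \<le> 0"
      by (auto elim!: eventually_mono)
    have "(q \<longlongrightarrow> - B * 0\<^sup>2 + (1 - B * 0 ^ 4) * (B * (r\<^sup>2 - 0\<^sup>2) - 1 / r\<^sup>2) - 4 * C * 0 - 4 * C\<^sup>2 * 0 ^ 4) (at_right 0)"
      unfolding q_def by (intro tendsto_intros)
    then have "(q \<longlongrightarrow> B * r\<^sup>2 - 1 / r\<^sup>2) (at_right 0)" by simp
    then show ?thesis
      using tendsto_upperbound[OF _ ev] trivial_limit_at_right_real by blast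
  qed
  have "\<forall>\<^sub>F r in at_left 1. B * r\<^sup>2 - 1 / r\<^sup>2 \<le> (0::real)"
    using eventually_at_left_real[of 0 1] Br by (auto elim!: eventually_mono)
  moreover have "((\<lambda>r. B * r\<^sup>2 - 1 / r\<^sup>2) \<longlongrightarrow> B * 1\<^sup>2 - 1 / 1\<^sup>2) (at_left (1::real))"
    by (intro tendsto_intros) auto
  ultimately have "B * 1\<^sup>2 - 1 / 1\<^sup>2 \<le> 0"
    using tendsto_upperbound trivial_limit_at_left_real by blast
  then show ?thesis
    unfolding B_def b_def by (simp add: abs_square_le_1)
qed

section \<open>Bieberbach's bound and the Koebe transform\<close>

text \<open>Since f''(0) = 2 a_2, this is |a_2| \<le> 2. Injectivity keeps f(z)/z free of zeros, so
  f(z) = z \<psi>(z)^2 with \<psi> holomorphic. Then f''(0) = 4 \<psi>(0) \<psi>'(0) with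
  |\<psi>(0)| = 1, while the derivative controlled by the area theorem is -\<psi>'(0) /
  \<psi>(0).\<close>

lemma bieberbach_second_coefficient:
  fixes f :: "complex \<Rightarrow> complex"
  assumes f: "f holomorphic_on ball 0 1" and inj: "inj_on f (ball 0 1)"
    and f0: "f 0 = 0" and df0: "deriv f 0 = 1"
  shows "cmod (deriv (deriv f) 0) \<le> 4"
proof -
  define \<phi> where "\<phi> = (\<lambda>z. if z = 0 then 1 else f z / z)"
  have "\<phi> holomorphic_on ball 0 1"
    by (rule pole_theorem_open_0[OF f, of 0]) (auto simp: \<phi>_def f0 df0)
  moreover have "\<phi> z \<noteq> 0" if "z \<in> ball 0 1" for z
    using inj_onD[OF inj, of z 0] that f0 by (auto simp: \<phi>_def)
  moreover have "contractible (ball (0::complex) 1)"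
    by (simp add: convex_imp_contractible)
  ultimately obtain \<psi> where \<psi>: "\<psi> holomorphic_on ball 0 1" and \<phi>\<psi>: "\<And>z. z \<in> ball 0 1 \<Longrightarrow> \<phi> z = (\<psi> z)\<^sup>2"
    using contractible_imp_holomorphic_sqrt by blast
  have \<psi>nz: "\<psi> z \<noteq> 0" if "z \<in> ball 0 1" for z
    using \<open>z \<in> ball 0 1 \<Longrightarrow> \<phi> z \<noteq> 0\<close> \<phi>\<psi>[OF that] that by auto
  have \<psi>0: "(\<psi> 0)\<^sup>2 = 1" using \<phi>\<psi>[of 0] by (simp add: \<phi>_def)
  have f_eq: "f z = z * (\<psi> z)\<^sup>2" if "z \<in> ball 0 1" for z
    using \<phi>\<psi>[OF that] f0 by (auto simp: \<phi>_def divide_simps split: if_splits)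
  \<comment> \<open>The square root may take the value -1 at 0; dividing by \<psi>(0) normalises to
    \<tau>(0) = 1 for either sign.\<close>
  define \<tau> where "\<tau> = (\<lambda>u. \<psi> 0 / \<psi> u)"
  have \<tau>: "\<tau> holomorphic_on ball 0 1"
    unfolding \<tau>_def by (intro holomorphic_intros \<psi>) (use \<psi>nz in auto)
  have \<tau>0: "\<tau> 0 = 1" using \<psi>nz[of 0] by (simp add: \<tau>_def)
  have \<tau>nz: "\<tau> u \<noteq> 0" if "u \<in> ball 0 1" for u
    using \<psi>nz[OF that] \<psi>nz[of 0] by (simp add: \<tau>_def)
  \<comment> \<open>Writing \<tau>(u) = 1 + u q(u) splits \<tau>(z^2) / z into the pole 1/z and the
    holomorphic part z q(z^2).\<close>
  define q where "q = (\<lambda>u. if u = 0 then deriv \<tau> 0 else (\<tau> u - 1) / u)"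
  have q: "q holomorphic_on ball 0 1"
  proof (rule pole_theorem_open_0[of "\<lambda>u. \<tau> u - 1" _ 0])
    have "(\<tau> has_field_derivative deriv \<tau> 0) (at 0)"
      by (rule holomorphic_derivI[OF \<tau>]) auto
    then have "((\<lambda>u. \<tau> u - 1) has_field_derivative deriv \<tau> 0) (at 0)"
      by (auto intro!: derivative_eq_intros)
    then show "q 0 = deriv (\<lambda>u. \<tau> u - 1) 0" by (simp add: q_def DERIV_imp_deriv)
  qed (auto simp: q_def \<tau>0 intro!: holomorphic_intros \<tau>)
  have sq: "z\<^sup>2 \<in> ball 0 1" if "z \<in> ball 0 1" for z :: complex
    using that by (simp add: norm_power power_less_one_iff)
  \<comment> \<open>\<open>1 / z + h z\<close> is a branch of \<open>\<plusminus> 1 / sqrt (f (z\<^sup>2))\<close>, univalent because it is odd.\<close>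
  define h where "h = (\<lambda>z. z * q (z\<^sup>2))"
  have qz: "(\<lambda>z. q (z\<^sup>2)) holomorphic_on ball 0 1"
    by (rule holomorphic_on_compose_gen[OF _ q, unfolded o_def]) (use sq in \<open>auto intro!: holomorphic_intros\<close>)
  have h: "h holomorphic_on ball 0 1"
    unfolding h_def by (intro holomorphic_intros qz)
  have g_eq: "1 / z + h z = \<tau> (z\<^sup>2) / z" if "z \<noteq> 0" for z
    using that by (simp add: h_def q_def field_simps power2_eq_square)
  have "inj_on (\<lambda>z. 1 / z + h z) (ball 0 1 - {0})"
  proof (rule inj_onI)
    fix z w assume z: "z \<in> ball 0 1 - {0}" and w: "w \<in> ball 0 1 - {0}" and "1 / z + h z = 1 / w + h w"
    then have eq: "\<tau> (z\<^sup>2) / z = \<tau> (w\<^sup>2) / w" by (simp add: g_eq)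
    have f_inv: "(\<tau> (z\<^sup>2) / z)\<^sup>2 = 1 / f (z\<^sup>2)" if "z \<in> ball 0 1" for z
      using \<psi>0 by (simp add: f_eq[OF sq[OF that]] \<tau>_def power_divide power_mult_distrib mult.commute)
    have "f (z\<^sup>2) = f (w\<^sup>2)" using f_inv[of z] f_inv[of w] eq z w by simp
    then have "z\<^sup>2 = w\<^sup>2" using inj_onD[OF inj] sq z w by blast
    then have "z = w \<or> z = - w" by (rule power2_eq_iff[THEN iffD1])
    moreover have "z \<noteq> - w"
    proof
      assume "z = - w"
      then have "\<tau> (w\<^sup>2) / w = 0" using eq by simp
      then show False using \<tau>nz sq w by auto
    qed
    ultimately show "z = w" by blast
  qed
  then have le: "cmod (deriv h 0) \<le> 1" by (rule area_theorem[OF h])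
  have "((\<lambda>z. q (z\<^sup>2)) has_field_derivative deriv (\<lambda>z. q (z\<^sup>2)) 0) (at 0)"
    by (rule holomorphic_derivI[OF qz]) auto
  then have "(h has_field_derivative 1 * q (0\<^sup>2) + deriv (\<lambda>z. q (z\<^sup>2)) 0 * 0) (at 0)"
    unfolding h_def by (intro DERIV_mult DERIV_ident)
  then have dh: "deriv h 0 = deriv \<tau> 0" by (simp add: DERIV_imp_deriv q_def)
  have d\<psi>: "(\<psi> has_field_derivative deriv \<psi> z) (at z)" if "z \<in> ball 0 1" for z
    using that by (intro holomorphic_derivI[OF \<psi>]) auto
  have "(\<tau> has_field_derivative - \<psi> 0 * deriv \<psi> 0 / (\<psi> 0 * \<psi> 0)) (at 0)"
    unfolding \<tau>_def using \<psi>nz[of 0] by (auto intro!: derivative_eq_intros d\<psi>)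
  then have d\<tau>: "deriv \<tau> 0 = - deriv \<psi> 0 / \<psi> 0"
    using \<psi>nz[of 0] by (simp add: DERIV_imp_deriv)
  have "deriv f z = (\<psi> z)\<^sup>2 + 2 * z * \<psi> z * deriv \<psi> z" if "z \<in> ball 0 1" for z
  proof -
    have "((\<lambda>z. z * (\<psi> z)\<^sup>2) has_field_derivative ((\<psi> z)\<^sup>2 + 2 * z * \<psi> z * deriv \<psi> z)) (at z)"
      by (rule derivative_eq_intros d\<psi>[OF that] refl)+ (simp add: algebra_simps)
    then have "(f has_field_derivative ((\<psi> z)\<^sup>2 + 2 * z * \<psi> z * deriv \<psi> z)) (at z)"
      by (rule has_field_derivative_transform_within_open[of _ _ _ "ball 0 1"]) (use that f_eq in auto)
    then show ?thesis by (rule DERIV_imp_deriv)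
  qed
  moreover have "((\<lambda>z. (\<psi> z)\<^sup>2 + 2 * z * \<psi> z * deriv \<psi> z) has_field_derivative 4 * \<psi> 0 * deriv \<psi> 0) (at 0)"
  proof -
    have "(deriv \<psi> has_field_derivative deriv (deriv \<psi>) 0) (at 0)"
      by (rule holomorphic_derivI[OF holomorphic_deriv[OF \<psi>]]) auto
    then show ?thesis
      by (auto intro!: derivative_eq_intros d\<psi>)
  qed
  ultimately have "(deriv f has_field_derivative 4 * \<psi> 0 * deriv \<psi> 0) (at 0)"
    by (intro has_field_derivative_transform_within_open[of "\<lambda>z. (\<psi> z)\<^sup>2 + 2 * z * \<psi> z * deriv \<psi> z" _ _ "ball 0 1" "deriv f"]) auto
  then have "deriv (deriv f) 0 = 4 * \<psi> 0 * deriv \<psi> 0" by (rule DERIV_imp_deriv)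
  moreover have "cmod (\<psi> 0) = 1"
    using arg_cong[OF \<psi>0, of cmod] by (simp add: norm_power abs_square_eq_1)
  ultimately show ?thesis
    using le by (simp add: dh d\<tau> norm_mult norm_divide)
qed

text \<open>The Koebe transform \<open>k\<close> is f composed with the disc automorphism \<phi>
  taking 0 to a, renormalised; here \<phi>'(0) = c = 1 - |a|^2. The expression under the modulus is
  k''(0), and its term -2 \<open>cnj\<close> a is \<phi>''(0) / \<phi>'(0).\<close>

lemma koebe_second_derivative_bound:
  fixes f :: "complex \<Rightarrow> complex"
  assumes f: "f holomorphic_on ball 0 1" and inj: "inj_on f (ball 0 1)" and a: "cmod a < 1"
  shows "cmod (of_real (1 - (cmod a)\<^sup>2) * deriv (deriv f) a / deriv f a - 2 * cnj a) \<le> 4"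
proof -
  define \<phi> where "\<phi> = Moebius_function 0 (- a)"
  define c where "c = complex_of_real (1 - (cmod a)\<^sup>2)"
  define k where "k = (\<lambda>z. (f (\<phi> z) - f a) / (c * deriv f a))"
  have c: "c = 1 - a * cnj a" unfolding c_def by (metis complex_norm_square of_real_1 of_real_diff)
  have "(cmod a)\<^sup>2 < 1" using a by (simp add: abs_square_less_1)
  then have cnz: "c \<noteq> 0" unfolding c_def of_real_eq_0_iff by simp
  have fnz: "deriv f a \<noteq> 0"
    using holomorphic_injective_imp_regular[OF f _ inj, of a] a by auto
  have \<phi>_eq: "\<phi> = (\<lambda>z. (z + a) / (1 + cnj a * z))"
    by (simp add: \<phi>_def Moebius_function_simple fun_eq_iff)
  have den: "1 + cnj a * z \<noteq> 0" if "z \<in> ball 0 1" for z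
  proof
    assume "1 + cnj a * z = 0"
    then have "cmod (cnj a * z) = 1" by (metis add_eq_0_iff norm_minus_cancel norm_one)
    moreover have "cmod a * cmod z < 1 * 1"
      using a that by (intro mult_strict_mono') auto
    ultimately show False by (simp add: norm_mult)
  qed
  have \<phi>: "\<phi> z \<in> ball 0 1" if "z \<in> ball 0 1" for z
    using Moebius_function_norm_lt_1[of "- a" z 0] a that by (simp add: \<phi>_def)
  have \<phi>0: "\<phi> 0 = a" by (simp add: \<phi>_eq)
  have d\<phi>: "(\<phi> has_field_derivative c / (1 + cnj a * z)\<^sup>2) (at z)" if "z \<in> ball 0 1" for z
    unfolding \<phi>_eq
    by (rule derivative_eq_intros refl den[OF that])+
       (use den[OF that] in \<open>simp add: c power2_eq_square algebra_simps\<close>)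
  have df: "(f has_field_derivative deriv f z) (at z)"
       "(deriv f has_field_derivative deriv (deriv f) z) (at z)" if "z \<in> ball 0 1" for z
    using that f by (auto intro!: holomorphic_derivI holomorphic_deriv)
  define k' where "k' = (\<lambda>z. deriv f (\<phi> z) / (deriv f a * (1 + cnj a * z)\<^sup>2))"
  have dk: "(k has_field_derivative k' z) (at z)" if "z \<in> ball 0 1" for z
  proof -
    have "((\<lambda>z. f (\<phi> z)) has_field_derivative deriv f (\<phi> z) * (c / (1 + cnj a * z)\<^sup>2)) (at z)"
      by (rule DERIV_chain2[OF df(1)[OF \<phi>[OF that]] d\<phi>[OF that]])
    then have "(k has_field_derivative (deriv f (\<phi> z) * (c / (1 + cnj a * z)\<^sup>2) - 0) / (c * deriv f a)) (at z)"
      unfolding k_def by (intro DERIV_cdivide DERIV_diff DERIV_const)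
    moreover have "(deriv f (\<phi> z) * (c / (1 + cnj a * z)\<^sup>2) - 0) / (c * deriv f a) = k' z"
      using cnz fnz by (simp add: k'_def field_simps)
    ultimately show ?thesis by simp
  qed
  have "(k' has_field_derivative c * deriv (deriv f) a / deriv f a - 2 * cnj a) (at 0)"
  proof -
    have "((\<lambda>z. deriv f (\<phi> z)) has_field_derivative deriv (deriv f) (\<phi> 0) * (c / (1 + cnj a * 0)\<^sup>2)) (at 0)"
      by (rule DERIV_chain2[OF df(2)[OF \<phi>] d\<phi>]) auto
    then have 1: "((\<lambda>z. deriv f (\<phi> z)) has_field_derivative deriv (deriv f) a * c) (at 0)"
      by (simp add: \<phi>0)
    have 2: "((\<lambda>z. deriv f a * (1 + cnj a * z)\<^sup>2) has_field_derivative deriv f a * (2 * cnj a)) (at 0)"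
      by (rule derivative_eq_intros refl)+ simp
    show ?thesis
      unfolding k'_def
      by (rule DERIV_cong[OF DERIV_divide[OF 1 2]])
         (use fnz in \<open>simp_all add: \<phi>0 field_simps\<close>)
  qed
  moreover have "deriv k z = k' z" if "z \<in> ball 0 1" for z
    using dk[OF that] by (rule DERIV_imp_deriv)
  ultimately have "(deriv k has_field_derivative c * deriv (deriv f) a / deriv f a - 2 * cnj a) (at 0)"
    by (intro has_field_derivative_transform_within_open[of k' _ _ "ball 0 1" "deriv k"]) auto
  then have "deriv (deriv k) 0 = c * deriv (deriv f) a / deriv f a - 2 * cnj a"
    by (rule DERIV_imp_deriv)
  moreover have "cmod (deriv (deriv k) 0) \<le> 4"
  proof (rule bieberbach_second_coefficient)
    show "k holomorphic_on ball 0 1"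
      using dk by (meson field_differentiable_at_within field_differentiable_def holomorphic_onI)
    show "inj_on k (ball 0 1)"
    proof (rule inj_onI)
      fix x y assume xy: "x \<in> ball 0 1" "y \<in> ball 0 1" "k x = k y"
      then have "f (\<phi> x) = f (\<phi> y)" using cnz fnz by (simp add: k_def)
      then have "\<phi> x = \<phi> y" using inj_onD[OF inj] \<phi> xy by blast
      then show "x = y"
        using Moebius_function_compose[of a "- a"] a xy unfolding \<phi>_def by (metis dist_0_norm mem_ball)
    qed
    show "deriv k 0 = 1"
      using DERIV_imp_deriv[OF dk[of 0]] fnz by (simp add: k'_def \<phi>0)
  qed (simp add: k_def \<phi>0)
  ultimately show ?thesis by (simp add: c_def)
qed

text \<open>For |z| = r the previous bound places z f''/f' in the disc with centre 2 r^2 / (1 - r^2)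
  and radius 4 r / (1 - r^2). The right side is the modulus of its point farthest from 0. A bound on
  the modulus is the right one because the exponents may have any argument.\<close>

lemma pre_Schwarzian_bound:
  fixes f :: "complex \<Rightarrow> complex"
  assumes f: "f holomorphic_on ball 0 1" and inj: "inj_on f (ball 0 1)" and z: "cmod z < 1"
  shows "cmod (z * deriv (deriv f) z / deriv f z) \<le> (4 * cmod z + 2 * (cmod z)\<^sup>2) / (1 - (cmod z)\<^sup>2)"
proof -
  define d where "d = 1 - (cmod z)\<^sup>2"
  define w where "w = deriv (deriv f) z / deriv f z"
  have d: "0 < d" using z by (simp add: d_def abs_square_less_1)
  have "d * cmod w = cmod (of_real d * w)" using d by (simp add: norm_mult)
  also have "\<dots> \<le> cmod (of_real d * w - 2 * cnj z) + cmod (2 * cnj z)"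
    by (metis diff_add_cancel norm_triangle_ineq)
  also have "\<dots> \<le> 4 + 2 * cmod z"
    using koebe_second_derivative_bound[OF f inj z] by (simp add: d_def w_def norm_mult)
  finally have "cmod z * (d * cmod w) \<le> cmod z * (4 + 2 * cmod z)"
    by (intro mult_left_mono) auto
  then have "cmod z * cmod w \<le> (4 * cmod z + 2 * (cmod z)\<^sup>2) / d"
    using d by (simp add: pos_le_divide_eq power2_eq_square algebra_simps)
  then show ?thesis by (simp add: d_def w_def norm_mult norm_divide)
qed

section \<open>Radius of convexity\<close>

text \<open>On the convex set F differs from a holomorphic primitive by a constant. F is prescribed
  on S only, so the derivative is transferred locally, using that S is open.\<close>

lemma has_field_derivative_segment_integral:
  assumes h: "h holomorphic_on S" and S: "convex S" "open S" "a \<in> S"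
    and F: "\<And>z. z \<in> S \<Longrightarrow> F z = contour_integral (linepath a z) h" and z: "z \<in> S"
  shows "(F has_field_derivative h z) (at z)"
proof -
  obtain g where g: "\<And>x. x \<in> S \<Longrightarrow> (g has_field_derivative h x) (at x within S)"
    using holomorphic_convex_primitive'[OF S(1,2) h] by blast
  have "F w = g w - g a" if "w \<in> S" for w
  proof -
    have "path_image (linepath a w) \<subseteq> S"
      using S that by (simp add: closed_segment_subset)
    then have "(h has_contour_integral (g w - g a)) (linepath a w)"
      using contour_integral_primitive[OF g, of "linepath a w"] by simp
    then show ?thesis using F[OF that] contour_integral_unique by simp
  qed
  moreover have "((\<lambda>w. g w - g a) has_field_derivative h z) (at z)"
    using DERIV_diff[OF g[OF z] DERIV_const] at_within_open[OF z S(2)] by simp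
  ultimately show ?thesis
    using S z by (intro has_field_derivative_transform_within_open[of "\<lambda>w. g w - g a" _ _ S F]) auto
qed

lemma has_field_derivative_prod_log_derivs:
  fixes p :: "'i \<Rightarrow> 'a::real_normed_field \<Rightarrow> 'a"
  assumes "finite I" "\<And>i. i \<in> I \<Longrightarrow> (p i has_field_derivative l i * p i z) (at z)"
  shows "((\<lambda>t. \<Prod>i\<in>I. p i t) has_field_derivative (\<Sum>i\<in>I. l i) * (\<Prod>i\<in>I. p i z)) (at z)"
  using assms
proof (induction I rule: finite_induct)
  case (insert j I)
  then have "((\<lambda>t. p j t * (\<Prod>i\<in>I. p i t)) has_field_derivative
     l j * p j z * (\<Prod>i\<in>I. p i z) + (\<Sum>i\<in>I. l i) * (\<Prod>i\<in>I. p i z) * p j z) (at z)"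
    by (intro DERIV_mult) auto
  with insert.hyps show ?case by (simp add: algebra_simps)
qed simp

text \<open>Differentiation erases the choice of logarithm: exp L = g forces L' = g'/g, and p = exp
  (c L) then has logarithmic derivative c L'.\<close>

lemma power_branch_log_derivative:
  assumes p: "power_branch g c p" and g: "g holomorphic_on unit_disc" and z: "z \<in> unit_disc"
  shows "(p has_field_derivative c * (deriv g z / g z) * p z) (at z)" and "p z \<noteq> 0"
proof -
  obtain L where L: "L analytic_on unit_disc"
    and eL: "\<And>z. z \<in> unit_disc \<Longrightarrow> exp (L z) = g z" and eP: "\<And>z. z \<in> unit_disc \<Longrightarrow> p z = exp (c * L z)"
    using p unfolding power_branch_def by blast
  have dL: "(L has_field_derivative deriv L z) (at z)"
    using L z by (intro holomorphic_derivI[OF analytic_imp_holomorphic]) auto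
  have "((\<lambda>z. exp (L z)) has_field_derivative exp (L z) * deriv L z) (at z)"
    by (auto intro!: derivative_eq_intros dL)
  then have "(g has_field_derivative exp (L z) * deriv L z) (at z)"
    by (rule has_field_derivative_transform_within_open[of _ _ _ unit_disc]) (use z eL in auto)
  then have "deriv g z / g z = deriv L z"
    using eL[OF z, symmetric] by (simp add: DERIV_imp_deriv)
  moreover have "((\<lambda>z. exp (c * L z)) has_field_derivative c * deriv L z * exp (c * L z)) (at z)"
    by (auto intro!: derivative_eq_intros dL)
  then have "(p has_field_derivative c * deriv L z * exp (c * L z)) (at z)"
    by (rule has_field_derivative_transform_within_open[of _ _ _ unit_disc]) (use z eP in auto)
  ultimately show "(p has_field_derivative c * (deriv g z / g z) * p z) (at z)"
    using eP[OF z] by simp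
  show "p z \<noteq> 0" using eP[OF z] by simp
qed

lemma class_S_holomorphic:
  assumes "f \<in> class_S"
  shows "f holomorphic_on unit_disc" "inj_on f unit_disc" "deriv f holomorphic_on unit_disc"
  using assms analytic_imp_holomorphic by (auto simp: class_S_def class_A_def intro!: holomorphic_deriv)

lemma convexity_quantity_integral_operator:
  assumes f: "\<And>i. i \<in> I \<Longrightarrow> f i \<in> class_S \<and> power_branch (deriv (f i)) (\<gamma> i) (p i)" and "finite I"
    and F: "\<And>z. z \<in> unit_disc \<Longrightarrow> F z = contour_integral (linepath 0 z) (\<lambda>t. \<Prod>i\<in>I. p i t)"
    and z: "z \<in> unit_disc"
  shows "convexity_quantity F z = Re (1 + (\<Sum>i\<in>I. \<gamma> i * (z * deriv (deriv (f i)) z / deriv (f i) z)))"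
proof -
  define P where "P = (\<lambda>t. \<Prod>i\<in>I. p i t)"
  define l where "l = (\<lambda>z. \<Sum>i\<in>I. \<gamma> i * (deriv (deriv (f i)) z / deriv (f i) z))"
  have dP: "(P has_field_derivative l z * P z) (at z)" if "z \<in> unit_disc" for z
    unfolding P_def l_def using f that
    by (intro has_field_derivative_prod_log_derivs \<open>finite I\<close> power_branch_log_derivative(1)
         class_S_holomorphic(3)) auto
  have Pnz: "P z \<noteq> 0"
    unfolding P_def using f z \<open>finite I\<close> power_branch_log_derivative(2) class_S_holomorphic(3)
    by (metis (no_types, lifting) prod_zero_iff)
  have "P holomorphic_on unit_disc"
    using dP by (meson field_differentiable_at_within field_differentiable_def holomorphic_onI)
  then have "(F has_field_derivative P z) (at z)" if "z \<in> unit_disc" for z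
    using F that by (intro has_field_derivative_segment_integral[of P unit_disc 0]) (auto simp: P_def)
  then have dF: "deriv F z = P z" if "z \<in> unit_disc" for z
    using that DERIV_imp_deriv by blast
  have "(deriv F has_field_derivative l z * P z) (at z)"
    by (rule has_field_derivative_transform_within_open[OF dP[OF z], of unit_disc]) (use z dF in auto)
  then have "z * deriv (deriv F) z / deriv F z = z * l z"
    using Pnz by (simp add: DERIV_imp_deriv dF[OF z])
  also have "\<dots> = (\<Sum>i\<in>I. \<gamma> i * (z * deriv (deriv (f i)) z / deriv (f i) z))"
    by (simp add: l_def sum_distrib_left mult_ac)
  finally show ?thesis by (simp add: convexity_quantity_def)
qed

section \<open>The Koebe function and the powers of its derivative\<close>

definition koebe :: "complex \<Rightarrow> complex" where
  "koebe z = z / (1 - z)\<^sup>2"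

lemma
  assumes z: "z \<in> unit_disc"
  shows deriv_koebe: "deriv koebe z = (1 + z) / (1 - z) ^ 3"
    and deriv2_koebe: "deriv (deriv koebe) z = (4 + 2 * z) / (1 - z) ^ 4"
proof -
  have d1: "(koebe has_field_derivative (1 + z) / (1 - z) ^ 3) (at z)" if "z \<in> unit_disc" for z
  proof -
    have nz: "1 - z \<noteq> 0" using that by auto
    have "(koebe has_field_derivative (1 * (1 - z)\<^sup>2 - z * (2 * (1 - z) * (0 - 1))) / ((1 - z)\<^sup>2 * (1 - z)\<^sup>2)) (at z)"
      unfolding koebe_def using nz
      by (auto intro!: derivative_eq_intros)
    moreover have "(1 * (1 - z)\<^sup>2 - z * (2 * (1 - z) * (0 - 1))) / ((1 - z)\<^sup>2 * (1 - z)\<^sup>2) = (1 + z) / (1 - z) ^ 3"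
    proof -
      have "(1 * (1 - z)\<^sup>2 - z * (2 * (1 - z) * (0 - 1))) = (1 + z) * (1 - z)" by (simp add: power2_eq_square algebra_simps)
      moreover have "(1 - z)\<^sup>2 * (1 - z)\<^sup>2 = (1 - z) ^ 3 * (1 - z)" by (simp add: power2_eq_square power3_eq_cube)
      ultimately show ?thesis using nz by simp
    qed
    ultimately show ?thesis by simp
  qed
  show "deriv koebe z = (1 + z) / (1 - z) ^ 3" using d1[OF z] by (rule DERIV_imp_deriv)
  have nz: "1 - z \<noteq> 0" using z by auto
  have "((\<lambda>z. (1 + z) / (1 - z) ^ 3) has_field_derivative
      (1 * (1 - z) ^ 3 - (1 + z) * (3 * (1 - z)\<^sup>2 * (0 - 1))) / ((1 - z) ^ 3 * (1 - z) ^ 3)) (at z)"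
    using nz by (auto intro!: derivative_eq_intros)
  moreover have "(1 * (1 - z) ^ 3 - (1 + z) * (3 * (1 - z)\<^sup>2 * (0 - 1))) / ((1 - z) ^ 3 * (1 - z) ^ 3) = (4 + 2 * z) / (1 - z) ^ 4"
  proof -
    have 1: "1 * (1 - z) ^ 3 - (1 + z) * (3 * (1 - z)\<^sup>2 * (0 - 1)) = (4 + 2 * z) * (1 - z)\<^sup>2"
      by (simp add: power2_eq_square power3_eq_cube algebra_simps)
    have 2: "(1 - z) ^ 3 * (1 - z) ^ 3 = (1 - z) ^ 4 * (1 - z)\<^sup>2"
      by (simp flip: power_add)
    show ?thesis unfolding 1 2 by (rule mult_divide_mult_cancel_right) (use nz in simp)
  qed
  ultimately have "((\<lambda>z. (1 + z) / (1 - z) ^ 3) has_field_derivative (4 + 2 * z) / (1 - z) ^ 4) (at z)" by simp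
  then have "(deriv koebe has_field_derivative (4 + 2 * z) / (1 - z) ^ 4) (at z)"
    by (rule has_field_derivative_transform_within_open[of _ _ _ unit_disc]) (use z DERIV_imp_deriv[OF d1] in auto)
  then show "deriv (deriv koebe) z = (4 + 2 * z) / (1 - z) ^ 4" by (rule DERIV_imp_deriv)
qed

lemma koebe_in_class_S: "koebe \<in> class_S"
proof -
  have "koebe holomorphic_on unit_disc"
    unfolding koebe_def by (intro holomorphic_intros) auto
  moreover have "inj_on koebe unit_disc"
  proof (rule inj_onI)
    fix z w assume z: "z \<in> unit_disc" and w: "w \<in> unit_disc" and eq: "koebe z = koebe w"
    have "1 - z \<noteq> 0" "1 - w \<noteq> 0" using z w by auto
    then have "z * (1 - w)\<^sup>2 = w * (1 - z)\<^sup>2"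
      using eq by (simp add: koebe_def frac_eq_eq del: right_minus_eq)
    then have "(z - w) * (1 - z * w) = 0" by (simp add: power2_eq_square algebra_simps)
    moreover have "cmod z * cmod w < 1 * 1"
      using z w by (intro mult_strict_mono') auto
    then have "1 - z * w \<noteq> 0"
      by (metis mult_1 norm_mult norm_one order_less_irrefl right_minus_eq)
    ultimately show "z = w" by simp
  qed
  ultimately show ?thesis
    by (simp add: class_S_def class_A_def analytic_on_open deriv_koebe) (simp add: koebe_def)
qed

text \<open>Both 1 + z and 1 - z stay in the right half-plane, so their principal logarithms are
  analytic, and their combination is a logarithm of (1 + z) / (1 - z)^3. The principal logarithm of
  the quotient itself would jump: its argument exceeds pi near boundary points close to 1.\<close>

lemma power_branch_deriv_koebe:
  "power_branch (deriv koebe) c (\<lambda>z. exp (c * (Ln (1 + z) - 3 * Ln (1 - z))))"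
proof -
  have nonpos: "1 + z \<notin> \<real>\<^sub>\<le>\<^sub>0" "1 - z \<notin> \<real>\<^sub>\<le>\<^sub>0" if "z \<in> unit_disc" for z
    using that abs_Re_le_cmod[of z] by (auto simp: complex_nonpos_Reals_iff)
  have "(\<lambda>z. Ln (1 + z) - 3 * Ln (1 - z)) holomorphic_on unit_disc"
    by (intro holomorphic_intros) (use nonpos in auto)
  moreover have "exp (Ln (1 + z) - 3 * Ln (1 - z)) = deriv koebe z" if "z \<in> unit_disc" for z
  proof -
    have "1 + z \<noteq> 0" "1 - z \<noteq> 0" using nonpos[OF that] by auto
    then show ?thesis
      using exp_of_nat_mult[of 3 "Ln (1 - z)"] by (simp add: deriv_koebe[OF that] exp_diff)
  qed
  ultimately show ?thesis
    unfolding power_branch_def by (auto simp: analytic_on_open)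
qed

section \<open>Sufficient and necessary conditions on the radius\<close>

text \<open>\<open>min_on_circle_nonneg\<close> asks for an attained minimum, so \<open>Q\<close>
  must be shown continuous on the circle; this rests on derivatives of univalent functions having no
  zeros. At the minimiser the pre-Schwarzian bound, weighted by the |\<gamma> i|, gives |Q| \<le> 1
  and hence Re (1 + Q) \<ge> 0.\<close>

lemma integral_operator_min_nonneg:
  assumes F: "F \<in> integral_operators n M" and r: "0 < r" "r < 1"
    and M: "M * ((4 * r + 2 * r\<^sup>2) / (1 - r\<^sup>2)) \<le> 1"
  shows "min_on_circle_nonneg (convexity_quantity F) r"
proof -
  obtain f \<gamma> p where fp: "\<And>i. i \<in> {1..n} \<Longrightarrow> f i \<in> class_S \<and> power_branch (deriv (f i)) (\<gamma> i) (p i)"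
    and \<gamma>: "(\<Sum>i=1..n. cmod (\<gamma> i)) \<le> M"
    and F: "\<And>z. z \<in> unit_disc \<Longrightarrow> F z = contour_integral (linepath 0 z) (\<lambda>t. \<Prod>i=1..n. p i t)"
    using F unfolding integral_operators_def by blast
  have sub: "sphere 0 r \<subseteq> unit_disc" using r by auto
  define Q where "Q = (\<lambda>z. \<Sum>i=1..n. \<gamma> i * (z * deriv (deriv (f i)) z / deriv (f i) z))"
  have q: "convexity_quantity F z = Re (1 + Q z)" if "z \<in> unit_disc" for z
    unfolding Q_def by (rule convexity_quantity_integral_operator[OF fp _ F that]) auto
  have "continuous_on unit_disc Q"
    unfolding Q_def
  proof (intro continuous_intros)
    fix i assume i: "i \<in> {1..n}"
    have S: "f i holomorphic_on unit_disc" "inj_on (f i) unit_disc"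
      using class_S_holomorphic fp[OF i] by blast+
    then show "continuous_on unit_disc (deriv (f i))" "continuous_on unit_disc (deriv (deriv (f i)))"
      by (auto intro!: holomorphic_on_imp_continuous_on holomorphic_deriv)
    show "\<forall>z\<in>unit_disc. deriv (f i) z \<noteq> 0"
      using holomorphic_injective_imp_regular[OF S(1) _ S(2)] by auto
  qed
  then have "continuous_on (sphere 0 r) (\<lambda>z. Re (1 + Q z))"
    by (intro continuous_intros) (rule continuous_on_subset[OF _ sub])
  moreover have "sphere (0::complex) r \<noteq> {}" using r by simp
  ultimately obtain z0 where z0: "z0 \<in> sphere 0 r" "\<forall>z\<in>sphere 0 r. Re (1 + Q z0) \<le> Re (1 + Q z)"
    using continuous_attains_inf[OF compact_sphere, of 0 r "\<lambda>z. Re (1 + Q z)"] by blast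
  have "cmod (Q z0) \<le> (\<Sum>i=1..n. cmod (\<gamma> i) * ((4 * r + 2 * r\<^sup>2) / (1 - r\<^sup>2)))"
    unfolding Q_def
  proof (rule sum_norm_le)
    fix i assume i: "i \<in> {1..n}"
    have S: "f i holomorphic_on unit_disc" "inj_on (f i) unit_disc"
      using class_S_holomorphic fp[OF i] by blast+
    have "cmod (z0 * deriv (deriv (f i)) z0 / deriv (f i) z0) \<le> (4 * r + 2 * r\<^sup>2) / (1 - r\<^sup>2)"
      using pre_Schwarzian_bound[OF S, of z0] z0(1) r by simp
    then show "cmod (\<gamma> i * (z0 * deriv (deriv (f i)) z0 / deriv (f i) z0)) \<le> cmod (\<gamma> i) * ((4 * r + 2 * r\<^sup>2) / (1 - r\<^sup>2))"
      unfolding norm_mult[of "\<gamma> i"] by (intro mult_left_mono) auto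
  qed
  also have "\<dots> = (\<Sum>i=1..n. cmod (\<gamma> i)) * ((4 * r + 2 * r\<^sup>2) / (1 - r\<^sup>2))"
    by (simp only: sum_distrib_right)
  also have "\<dots> \<le> M * ((4 * r + 2 * r\<^sup>2) / (1 - r\<^sup>2))"
    using \<gamma> r by (intro mult_right_mono) (auto simp: power_le_one)
  also have "\<dots> \<le> 1" by (rule M)
  finally have "0 \<le> Re (1 + Q z0)"
    using abs_Re_le_cmod[of "Q z0"] by simp
  then show ?thesis
    unfolding min_on_circle_nonneg_def using z0 q sub by (metis subsetD)
qed

lemma convexity_radii_integral_operators_imp:
  assumes "n \<ge> 1" "M \<ge> 0" and s: "s \<in> convexity_radii (integral_operators n M)"
  shows "M * ((4 * s + 2 * s\<^sup>2) / (1 - s\<^sup>2)) \<le> 1"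
proof -
  have s01: "0 < s" "s < 1" using s by (auto simp: convexity_radii_def)
  \<comment> \<open>The whole weight M sits on the first factor, which exists because n \<ge> 1; the
    other exponents are 0 and contribute factors equal to 1. The sign makes the exponent oppose the
    positive value of z k''/k' at z = s for the Koebe function k.\<close>
  define \<gamma> :: "nat \<Rightarrow> complex" where "\<gamma> = (\<lambda>i. if i = 1 then - of_real M else 0)"
  define p where "p = (\<lambda>i z. exp (\<gamma> i * (Ln (1 + z) - 3 * Ln (1 - z))))"
  define F where "F = (\<lambda>z. contour_integral (linepath 0 z) (\<lambda>t. \<Prod>i=1..n. p i t))"
  have fp: "koebe \<in> class_S \<and> power_branch (deriv koebe) (\<gamma> i) (p i)" for i
    unfolding p_def using koebe_in_class_S power_branch_deriv_koebe by blast
  have "(\<Sum>i=1..n. cmod (\<gamma> i)) = (\<Sum>i\<in>{1..n}. if i = 1 then M else 0)"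
    using \<open>M \<ge> 0\<close> by (intro sum.cong) (auto simp: \<gamma>_def)
  also have "\<dots> = M" using \<open>n \<ge> 1\<close> by simp
  finally have "F \<in> integral_operators n M"
    unfolding integral_operators_def using fp F_def
    by (intro CollectI exI[of _ "\<lambda>i. koebe"] exI[of _ \<gamma>] exI[of _ p]) auto
  then obtain z0 where z0: "\<forall>z\<in>sphere 0 s. convexity_quantity F z0 \<le> convexity_quantity F z" "0 \<le> convexity_quantity F z0"
    using s unfolding convexity_radii_def min_on_circle_nonneg_def by blast
  have "0 \<le> convexity_quantity F z0" by (rule z0(2))
  \<comment> \<open>The extremal point is the positive one on the circle, where the quantity is 1 -
    M (4 s + 2 s^2) / (1 - s^2).\<close>
  also have "\<dots> \<le> convexity_quantity F (of_real s)"
    using z0(1) s01 by simp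
  also have sd: "complex_of_real s \<in> unit_disc" using s01 by simp
  then have "convexity_quantity F (of_real s)
      = Re (1 + (\<Sum>i=1..n. \<gamma> i * (of_real s * deriv (deriv koebe) (of_real s) / deriv koebe (of_real s))))"
    using fp by (intro convexity_quantity_integral_operator[of "{1..n}" "\<lambda>i. koebe" \<gamma> p]) (auto simp: F_def)
  also have "complex_of_real s * deriv (deriv koebe) (of_real s) / deriv koebe (of_real s)
      = of_real ((4 * s + 2 * s\<^sup>2) / (1 - s\<^sup>2))"
  proof -
    have "s * ((4 + 2 * s) / (1 - s) ^ 4) / ((1 + s) / (1 - s) ^ 3) = (4 * s + 2 * s\<^sup>2) / (1 - s\<^sup>2)"
    proof -
      have "(1 - s) ^ 4 = (1 - s) * (1 - s) ^ 3" by (simp add: power4_eq_xxxx power3_eq_cube)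
      moreover have "1 - s\<^sup>2 = (1 - s) * (1 + s)" by (simp add: power2_eq_square algebra_simps)
      ultimately show ?thesis using s01 by simp (simp add: power2_eq_square algebra_simps)
    qed
    from arg_cong[OF this, of complex_of_real] show ?thesis
      by (simp add: deriv_koebe[OF sd] deriv2_koebe[OF sd])
  qed
  also have "(\<Sum>i=1..n. \<gamma> i * of_real ((4 * s + 2 * s\<^sup>2) / (1 - s\<^sup>2))) = (\<Sum>i=1..n. \<gamma> i) * of_real ((4 * s + 2 * s\<^sup>2) / (1 - s\<^sup>2))"
    by (simp only: sum_distrib_right)
  also have "(\<Sum>i=1..n. \<gamma> i) = - of_real M"
    unfolding \<gamma>_def using \<open>n \<ge> 1\<close> by simp
  finally show ?thesis by (simp flip: of_real_mult)
qed

theorem theorem2p2: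
  fixes n :: nat and M :: real
  assumes "n \<ge> 1" and "M > 0"
  shows "is_radius_of_convexity (integral_operators n M)
           (1 / (sqrt (4 * M\<^sup>2 + 2 * M + 1) + 2 * M))"
proof -
  \<comment> \<open>Clearing denominators in M (4 r + 2 r^2) / (1 - r^2) = 1 gives (1 + 2 M) r^2 + 4
    M r = 1. In terms of t = 1/r this is the monic equation t^2 = 4 M t + 2 M + 1, and the value
    chosen is its positive root.\<close>
  define t where "t = sqrt (4 * M\<^sup>2 + 2 * M + 1) + 2 * M"
  define r where "r = 1 / t"
  have "(t - 2 * M)\<^sup>2 = 4 * M\<^sup>2 + 2 * M + 1"
    unfolding t_def using \<open>M > 0\<close> by simp
  then have t: "t\<^sup>2 = 4 * M * t + 2 * M + 1" by (simp add: power2_eq_square algebra_simps)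
  have "1 \<le> sqrt (4 * M\<^sup>2 + 2 * M + 1)" using \<open>M > 0\<close> by simp
  then have "1 < t" using \<open>M > 0\<close> unfolding t_def by linarith
  then have r: "0 < r" "r < 1" by (auto simp: r_def)
  have root: "(1 + 2 * M) * r\<^sup>2 + 4 * M * r = 1"
  proof -
    have "(1 + 2 * M) * r\<^sup>2 + 4 * M * r = (4 * M * t + 2 * M + 1) / t\<^sup>2"
      using \<open>1 < t\<close> by (simp add: r_def power2_eq_square field_simps)
    then show ?thesis using \<open>1 < t\<close> unfolding t[symmetric] by simp
  qed
  have iff: "M * ((4 * s + 2 * s\<^sup>2) / (1 - s\<^sup>2)) \<le> 1 \<longleftrightarrow> (1 + 2 * M) * s\<^sup>2 + 4 * M * s \<le> 1"
    if "0 < s" "s < 1" for s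
  proof -
    have "0 < 1 - s\<^sup>2" using that by (simp add: abs_square_less_1)
    then show ?thesis by (simp add: pos_divide_le_eq algebra_simps)
  qed
  have "r \<in> convexity_radii (integral_operators n M)"
    unfolding convexity_radii_def
    using r iff[OF r] root integral_operator_min_nonneg by auto
  moreover have "s \<le> r" if s: "s \<in> convexity_radii (integral_operators n M)" for s
  proof (rule ccontr)
    assume "\<not> s \<le> r"
    have s01: "0 < s" "s < 1" using s by (auto simp: convexity_radii_def)
    have "M * ((4 * s + 2 * s\<^sup>2) / (1 - s\<^sup>2)) \<le> 1"
      using convexity_radii_integral_operators_imp[OF _ _ s] assms by simp
    \<comment> \<open>The quadratic is strictly increasing on positive arguments and equals 1 at r,
      so an admissible s cannot exceed r.\<close>
    then have "(1 + 2 * M) * s\<^sup>2 + 4 * M * s \<le> (1 + 2 * M) * r\<^sup>2 + 4 * M * r"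
      using iff[OF s01] root by simp
    moreover have "(1 + 2 * M) * r\<^sup>2 < (1 + 2 * M) * s\<^sup>2"
      using \<open>\<not> s \<le> r\<close> r \<open>M > 0\<close> by (intro mult_strict_left_mono power_strict_mono) auto
    moreover have "4 * M * r < 4 * M * s" using \<open>\<not> s \<le> r\<close> \<open>M > 0\<close> by simp
    ultimately show False by linarith
  qed
  ultimately show ?thesis
    unfolding is_radius_of_convexity_def r_def t_def by blast
qed

end
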